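(* Fix an integer $N\geq 2$ and real numbers $n_0<\cdots<n_{N-1}<M$. Also fix a real number $\rho>0$ and $c_{n_0},\ldots,c_{n_{N-1}},c'\in\mathbb{R}$, and define $f:(0,\rho)\to\mathbb{R}$ by $$f(x):=\sum_{j=0}^{N-1}c_{n_j}x^{n_j}+c'x^M.$$ Let $\mathcal{A}_N:=\mathbb{N}_0\cup[N-2,\infty)$ and, if $c_{n_j}>0$ for every $j$, define $$\mathcal{C}:=\sum_{j=0}^{N-1}\frac{V(\mathbf{n}_j)^2}{V(\mathbf{n})^2}\,\frac{\rho^{M-n_j}}{c_{n_j}},$$ where $\mathbf{n}:=(n_0,\ldots,n_{N-1})$ and $\mathbf{n}_j:=(n_0,\ldots,n_{j-1},n_{j+1},\ldots,n_{N-1},M)$. Then the following are equivalent: (i) for every $A\in\mathbb{P}_N((0,\rho))$, one has $f[A]\succeq 0$; (ii) one of the following two mutually exclusive conditions holds: (1) all the coefficients $c_{n_0},\dots,c_{n_{N-1}},c'$ are nonnegative, and $c_{n_j}>0\Rightarrow n_j\in\mathcal{A}_N$ for each $j$, and $c'>0\Rightarrow M\in\mathcal{A}_N$; (2) for all $0\leq j\leq N-1$ we have $c_{n_j}>0$ and $n_j\in\mathcal{A}_N$, and $-\mathcal{C}^{-1}\leq c'<0$. Moreover, in case (2), $f[-]$ does not preserve positivity on $\mathbb{P}_{N+1}((0,\rho))$, i.e. there exists $A\in\mathbb{P}_{N+1}((0,\rho))$ such that $f[A]$ is not positive semidefinite.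
   Context: $\mathbb{N}_0=\{0,1,2,\ldots\}$. $\mathbb{P}_n(I)$ denotes the set of real symmetric positive semidefinite $n\times n$ matrices all of whose entries lie in $I$; $f[A]:=[f(a_{ij})]$ is the entrywise application of $f$; $\succeq 0$ means positive semidefinite. For $\mathbf{u}=(u_1,\ldots,u_N)\in\mathbb{R}^N$, $V(\mathbf{u})$ denotes the Vandermonde determinant, i.e. the determinant of the $N\times N$ matrix whose $(k,i)$ entry is $u_k^{\,i-1}$ for $1\le k,i\le N$ (with $u^0=1$). *)

theory Defs
  imports Complex_Main "Jordan_Normal_Form.Determinant"
begin

definition psd_mat :: "nat \<Rightarrow> real mat \<Rightarrow> bool" where
  "psd_mat m A \<longleftrightarrow> A \<in> carrier_mat m m \<and> transpose_mat A = A \<and>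
     (\<forall>v \<in> carrier_vec m. v \<bullet> (A *\<^sub>v v) \<ge> 0)"

definition PSD :: "nat \<Rightarrow> real set \<Rightarrow> real mat set" where
  "PSD m I = {A. psd_mat m A \<and> (\<forall>i<m. \<forall>j<m. A $$ (i, j) \<in> I)}"

text \<open>Indices are shifted to start at 0, so the entry in row \<open>k\<close> and column \<open>i\<close> is the
  \<open>i\<close>-th power of the \<open>k\<close>-th component; \<open>^\<close> satisfies \<open>0 ^ 0 = 1\<close>.\<close>

definition vandermonde_det :: "real list \<Rightarrow> real" where
  "vandermonde_det u = det (mat (length u) (length u) (\<lambda>(k, i). (u ! k) ^ i))"

definition admissible_powers :: "nat \<Rightarrow> real set" where
  "admissible_powers N = \<nat> \<union> {real N - 2..}"

definition exponents :: "nat \<Rightarrow> (nat \<Rightarrow> real) \<Rightarrow> real list" where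
  "exponents N n = map n [0..<N]"

definition exponents_swap :: "nat \<Rightarrow> (nat \<Rightarrow> real) \<Rightarrow> real \<Rightarrow> nat \<Rightarrow> real list" where
  "exponents_swap N n M j = map n ([0..<j] @ [Suc j..<N]) @ [M]"

text \<open>The coefficient of the \<open>j\<close>-th power is \<open>c j\<close>. The constant is only meaningful when
  \<open>c j > 0\<close> for all \<open>j < N\<close>.\<close>

definition threshold_const ::
  "nat \<Rightarrow> (nat \<Rightarrow> real) \<Rightarrow> real \<Rightarrow> (nat \<Rightarrow> real) \<Rightarrow> real \<Rightarrow> real" where
  "threshold_const N n M c \<rho> =
     (\<Sum>j<N. (vandermonde_det (exponents_swap N n M j))\<^sup>2 / (vandermonde_det (exponents N n))\<^sup>2
              * (\<rho> powr (M - n j) / c j))"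

definition nonneg_case ::
  "nat \<Rightarrow> (nat \<Rightarrow> real) \<Rightarrow> real \<Rightarrow> (nat \<Rightarrow> real) \<Rightarrow> real \<Rightarrow> bool" where
  "nonneg_case N n M c c' \<longleftrightarrow>
     (\<forall>j<N. c j \<ge> 0) \<and> c' \<ge> 0 \<and>
     (\<forall>j<N. c j > 0 \<longrightarrow> n j \<in> admissible_powers N) \<and>
     (c' > 0 \<longrightarrow> M \<in> admissible_powers N)"

definition negative_case ::
  "nat \<Rightarrow> (nat \<Rightarrow> real) \<Rightarrow> real \<Rightarrow> (nat \<Rightarrow> real) \<Rightarrow> real \<Rightarrow> real \<Rightarrow> bool" where
  "negative_case N n M c c' \<rho> \<longleftrightarrow>
     (\<forall>j<N. c j > 0 \<and> n j \<in> admissible_powers N) \<and>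
     - inverse (threshold_const N n M c \<rho>) \<le> c' \<and> c' < 0"

end

theory Submission
  imports
    "HOL-Analysis.Generalised_Binomial_Theorem"
    "HOL-Computational_Algebra.Polynomial"
    Defs
begin

text \<open>
  Writing \<open>u\<^sub>i = exp t\<^sub>i\<close>, the quadratic form of \<open>f[u u\<^sup>T]\<close> at \<open>v\<close> is
  \<open>\<Sum>\<^sub>j c\<^sub>j y\<^sub>j\<^sup>2 + c' y\<^sub>M\<^sup>2\<close>, where \<open>y\<^sub>a = \<Sum>\<^sub>i v\<^sub>i exp (a t\<^sub>i)\<close>. Interpolating \<open>exp (M t)\<close> at the nodes by
  \<open>\<Sum>\<^sub>j b\<^sub>j exp (n\<^sub>j t)\<close> gives \<open>y\<^sub>M = \<Sum>\<^sub>j b\<^sub>j y\<^sub>j\<close>, so by Cauchy--Schwarz positivity for all \<open>v\<close> means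
  \<open>- c' \<Sum>\<^sub>j b\<^sub>j\<^sup>2 / c\<^sub>j \<le> 1\<close>. A Rolle argument yields
  \<open>b\<^sub>j = exp ((M - n\<^sub>j) \<xi>) \<Prod>\<^sub>l (M - n\<^sub>l) / (n\<^sub>j - n\<^sub>l)\<close> for some \<open>\<xi>\<close> in the hull of the nodes, and the
  product is \<open>\<plusminus> V(n\<^sub>j) / V(n)\<close>. This gives the threshold for rank one matrices, attained in the
  limit as all nodes tend to \<open>(ln \<rho>) / 2\<close>. The FitzGerald--Horn integration argument passes from
  rank one to arbitrary matrices: it reduces the claim to \<open>f'\<close> in dimension \<open>N - 1\<close>, where the
  term of smallest exponent can be dropped. Conversely, test vectors with prescribed moments force
  the signs of the coefficients, and a Horn--Loewner argument forces the exponents.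
\<close>

section \<open>Sums of exponentials\<close>

lemma Rolle_card:
  fixes g g' :: "real \<Rightarrow> real"
  assumes "finite T" "T \<noteq> {}" "T \<subseteq> {lo..hi}" "\<forall>t\<in>T. g t = 0"
    and der: "\<And>t. (g has_real_derivative g' t) (at t)"
  shows "\<exists>T'. finite T' \<and> Suc (card T') = card T \<and> T' \<subseteq> {lo..hi} \<and> (\<forall>t\<in>T'. g' t = 0)"
proof -
  \<comment> \<open>The induction carries the bound \<open>t < Max T\<close>: the zero found between
    the old maximum \<open>a\<close> and the new point \<open>b\<close> is then different from all
    earlier ones.\<close>
  have "\<exists>T'. finite T' \<and> Suc (card T') = card T \<and> T' \<subseteq> {lo..hi} \<and> (\<forall>t\<in>T'. t < Max T)
      \<and> (\<forall>t\<in>T'. g' t = 0)"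
    using assms(1-4)
  proof (induction T rule: finite_linorder_max_induct)
    case empty
    then show ?case by simp
  next
    case (insert b T)
    show ?case
    proof (cases "T = {}")
      case True
      then show ?thesis by (intro exI[of _ "{}"]) auto
    next
      case False
      with insert obtain T' where T': "finite T'" "Suc (card T') = card T" "T' \<subseteq> {lo..hi}"
        "\<forall>t\<in>T'. t < Max T" "\<forall>t\<in>T'. g' t = 0" by auto
      define a where "a = Max T"
      have a: "a \<in> T" "a < b" using insert False by (auto simp: a_def)
      have "\<exists>z. a < z \<and> z < b \<and> g b - g a = (b - a) * g' z"
        using a by (intro MVT2) (auto intro: der)
      then obtain z where z: "a < z" "z < b" "g b - g a = (b - a) * g' z" by auto
      then have "g' z = 0" using insert.prems a by simp
      moreover have "Max (insert b T) = b"
        using insert by (intro Max_eqI) (auto intro: less_imp_le)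
      moreover have "z \<in> {lo..hi}" using z insert.prems a by fastforce
      moreover have "z \<notin> T'" using T' z(1) unfolding a_def by force
      moreover have "\<forall>t\<in>T'. t < b" using T'(4) a unfolding a_def by force
      moreover have "b \<notin> T" using insert by auto
      ultimately show ?thesis
        using T' z insert.hyps(1) by (intro exI[of _ "insert z T'"]) auto
    qed
  qed
  then show ?thesis by blast
qed

text \<open>The factor \<open>exp (- l * t)\<close> changes no zero, and differentiating the product
  multiplies the coefficient of \<open>e j\<close> by \<open>e j - l\<close>. Taking
  \<open>l\<close> among the exponents thus removes a term at the cost of one zero.\<close>

lemma exp_sum_Rolle:
  fixes e b :: "'j \<Rightarrow> real"
  assumes "finite T" "T \<noteq> {}" "T \<subseteq> {lo..hi}" "\<forall>t\<in>T. (\<Sum>j\<in>J. b j * exp (e j * t)) = 0"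
  shows "\<exists>T'. finite T' \<and> Suc (card T') = card T \<and> T' \<subseteq> {lo..hi} \<and>
    (\<forall>t\<in>T'. (\<Sum>j\<in>J. ((e j - l) * b j) * exp (e j * t)) = 0)"
proof -
  let ?g = "\<lambda>t. \<Sum>j\<in>J. b j * exp ((e j - l) * t)"
  let ?g' = "\<lambda>t. \<Sum>j\<in>J. ((e j - l) * b j) * exp ((e j - l) * t)"
  have fac: "(\<Sum>j\<in>J. d j * exp ((e j - l) * t)) = exp (- l * t) * (\<Sum>j\<in>J. d j * exp (e j * t))"
    for d :: "'j \<Rightarrow> real" and t
    by (simp add: sum_distrib_left algebra_simps flip: exp_add)
  have "(?g has_real_derivative ?g' t) (at t)" for t
    by (auto intro!: derivative_eq_intros sum.cong)
  from Rolle_card[OF assms(1-3) _ this] assms(4) show ?thesis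
    unfolding fac by simp
qed

text \<open>Induction on the number of exponents: a Rolle step at some \<open>l \<noteq> i\<close>
  deletes the term \<open>l\<close> and costs one zero, while \<open>b i\<close> survives up to the
  nonzero factor \<open>e i - e l\<close>.\<close>

lemma exp_sum_nonsingular:
  fixes e b :: "'j \<Rightarrow> real"
  assumes "finite J" "inj_on e J" "finite T" "card J \<le> card T"
    and "\<forall>t\<in>T. (\<Sum>j\<in>J. b j * exp (e j * t)) = 0" "i \<in> J"
  shows "b i = 0"
  using assms
proof (induction "card J" arbitrary: J T b)
  case 0
  then show ?case by simp
next
  case (Suc m)
  have Tne: "T \<noteq> {}" using Suc by auto
  show ?case
  proof (cases "m = 0")
    case True
    then obtain k where "J = {k}" using Suc.hyps(2) by (metis One_nat_def card_1_singletonE)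
    then show ?thesis using Suc Tne by auto
  next
    case False
    then obtain l where l: "l \<in> J" "l \<noteq> i"
      using Suc.hyps(2) Suc.prems(1,6) by (metis card_1_singletonE card_Suc_eq is_singletonI is_singleton_altdef
          nat.inject One_nat_def singletonI subset_singletonD subsetI insert_iff card_0_eq)
    obtain T' where T': "finite T'" "Suc (card T') = card T"
      "\<forall>t\<in>T'. (\<Sum>j\<in>J. ((e j - e l) * b j) * exp (e j * t)) = 0"
      using exp_sum_Rolle[OF Suc.prems(3) Tne _ Suc.prems(5), of "Min T" "Max T" "e l"]
        Min_le[OF Suc.prems(3)] Max_ge[OF Suc.prems(3)]
      by (auto simp: subset_iff)
    have "(e i - e l) * b i = 0"
    proof (rule Suc.hyps(1)[of "J - {l}" T' "\<lambda>j. (e j - e l) * b j"])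
      show "\<forall>t\<in>T'. (\<Sum>j\<in>J - {l}. ((e j - e l) * b j) * exp (e j * t)) = 0"
        using T'(3) Suc.prems(1) l by (simp add: sum_diff1)
    qed (use Suc.prems Suc.hyps(2) l T' in \<open>auto intro: inj_on_diff simp: card_Diff_singleton\<close>)
    moreover have "e i \<noteq> e l" using Suc.prems(2,6) l by (auto dest: inj_onD)
    ultimately show ?thesis by simp
  qed
qed

text \<open>One node and one exponent are added at a time, as in Newton interpolation:
  \<open>h\<close> is an exponential sum vanishing at the old nodes, so adding a multiple of it
  repairs the value at \<open>z\<close> and disturbs nothing else.\<close>

lemma exp_sum_interpolation:
  fixes e :: "'j \<Rightarrow> real" and t y :: "'i \<Rightarrow> real"
  assumes "finite I" "finite J" "card I = card J" "inj_on e J" "inj_on t I"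
  shows "\<exists>b. \<forall>i\<in>I. (\<Sum>j\<in>J. b j * exp (e j * t i)) = y i"
  using assms
proof (induction I arbitrary: J y rule: finite_induct)
  case empty
  then show ?case by simp
next
  case (insert z I)
  obtain k K where J: "J = insert k K" "k \<notin> K"
    using insert.prems insert.hyps by (metis card_0_eq card_insert_disjoint equals0I mk_disjoint_insert nat.distinct(1))
  have K: "finite K" "card I = card K" "inj_on e K" "inj_on t I"
    using insert J by auto
  obtain a where a: "\<forall>i\<in>I. (\<Sum>j\<in>K. a j * exp (e j * t i)) = exp (e k * t i)"
    using insert.IH[OF K, of "\<lambda>i. exp (e k * t i)"] by blast
  obtain b where b: "\<forall>i\<in>I. (\<Sum>j\<in>K. b j * exp (e j * t i)) = y i"
    using insert.IH[OF K, of y] by blast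
  define h where "h x = exp (e k * x) - (\<Sum>j\<in>K. a j * exp (e j * x))" for x
  have h0: "h (t i) = 0" if "i \<in> I" for i using a that by (simp add: h_def)
  have h_sum: "\<mu> * h x + (\<Sum>j\<in>K. d j * exp (e j * x)) =
      (\<Sum>j\<in>J. (if j = k then \<mu> else d j - \<mu> * a j) * exp (e j * x))" for \<mu> d x
  proof -
    have "(\<Sum>j\<in>K. (if j = k then \<mu> else d j - \<mu> * a j) * exp (e j * x)) =
      (\<Sum>j\<in>K. (d j - \<mu> * a j) * exp (e j * x))"
      using J by (intro sum.cong) auto
    then show ?thesis using J K
      by (simp add: h_def algebra_simps sum_subtractf sum_distrib_left)
  qed
  \<comment> \<open>Otherwise \<open>h\<close>, in which \<open>exp (e k * x)\<close> has
    coefficient 1, would vanish at as many nodes as it has exponents.\<close>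
  have "h (t z) \<noteq> 0"
  proof
    assume hz: "h (t z) = 0"
    have "(if k = k then 1 else 0 - 1 * a k) = 0"
    proof (rule exp_sum_nonsingular[of J e "t ` insert z I" "\<lambda>j. if j = k then 1 else 0 - 1 * a j"])
      show "\<forall>x\<in>t ` insert z I. (\<Sum>j\<in>J. (if j = k then 1 else 0 - 1 * a j) * exp (e j * x)) = 0"
        using hz h0 unfolding h_sum[symmetric] by auto
      show "card J \<le> card (t ` insert z I)"
        using insert.prems by (simp only: card_image)
    qed (use insert.prems insert.hyps J in auto)
    then show False by simp
  qed
  define \<mu> where "\<mu> = (y z - (\<Sum>j\<in>K. b j * exp (e j * t z))) / h (t z)"
  have "\<mu> * h (t i) + (\<Sum>j\<in>K. b j * exp (e j * t i)) = y i" if "i \<in> insert z I" for i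
  proof (cases "i = z")
    case True
    then show ?thesis using \<open>h (t z) \<noteq> 0\<close> by (simp add: \<mu>_def)
  next
    case False
    then show ?thesis using that h0 b by simp
  qed
  then have "\<forall>i\<in>insert z I.
      (\<Sum>j\<in>J. (if j = k then \<mu> else b j - \<mu> * a j) * exp (e j * t i)) = y i"
    by (simp only: h_sum) simp
  then show ?case by (intro exI[of _ "\<lambda>j. if j = k then \<mu> else b j - \<mu> * a j"])
qed

text \<open>\<open>exp (e * t)\<close> is symmetric in exponents and nodes, so interpolation also
  yields functionals with prescribed moments.\<close>

corollary exp_sum_moments:
  fixes e y :: "'j \<Rightarrow> real" and t :: "'i \<Rightarrow> real"
  assumes "finite I" "finite J" "card I = card J" "inj_on e J" "inj_on t I"
  obtains v where "\<And>j. j \<in> J \<Longrightarrow> (\<Sum>i\<in>I. v i * exp (e j * t i)) = y j"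
  using exp_sum_interpolation[of J I t e y] assms by (auto simp: mult.commute)

text \<open>The Lagrange basis polynomial of the nodes \<open>e l\<close> belonging to
  \<open>e j\<close>, evaluated at \<open>M\<close>. For \<open>J = {..<N}\<close> its square is the
  squared ratio of Vandermonde determinants in the threshold.\<close>

definition node_ratio :: "('j \<Rightarrow> real) \<Rightarrow> real \<Rightarrow> 'j set \<Rightarrow> 'j \<Rightarrow> real" where
  "node_ratio e M J j = (\<Prod>l\<in>J - {j}. (M - e l) / (e j - e l))"

lemma node_ratio_remove:
  assumes "finite J" "l \<in> J" "l \<noteq> j"
  shows "node_ratio e M J j = (M - e l) / (e j - e l) * node_ratio e M (J - {l}) j"
proof -
  have "J - {j} - {l} = J - {l} - {j}" by auto
  then show ?thesis unfolding node_ratio_def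
    using assms by (subst prod.remove[of _ l]) auto
qed

text \<open>Mean value form of the interpolation coefficients. Dividing by \<open>exp (e l * t)\<close> and
  differentiating removes the exponent \<open>e l\<close>, at the cost of one zero by Rolle's theorem.\<close>

lemma exp_interpolation_coeff:
  fixes e b :: "'j \<Rightarrow> real"
  assumes "finite J" "inj_on e J" "finite T" "card J = card T" "T \<subseteq> {lo..hi}"
    and "\<forall>t\<in>T. (\<Sum>j\<in>J. b j * exp (e j * t)) = \<beta> * exp (M * t)" "i \<in> J"
  shows "\<exists>\<xi>\<in>{lo..hi}. b i = \<beta> * node_ratio e M J i * exp ((M - e i) * \<xi>)"
  using assms
proof (induction "card J" arbitrary: J T b \<beta>)
  case 0
  then show ?case by simp
next
  case (Suc m)
  have Tne: "T \<noteq> {}" using Suc by auto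
  show ?case
  proof (cases "m = 0")
    case True
    then obtain k where "J = {k}" using Suc.hyps(2) by (metis One_nat_def card_1_singletonE)
    moreover obtain t where t: "t \<in> T" using Tne by blast
    ultimately have "b i * exp (e i * t) = \<beta> * exp (M * t)" "J - {i} = {}" using Suc by auto
    then have "b i = \<beta> * exp ((M - e i) * t)"
      by (simp add: algebra_simps exp_diff eq_divide_eq)
    then have "b i = \<beta> * node_ratio e M J i * exp ((M - e i) * t)"
      unfolding node_ratio_def \<open>J - {i} = {}\<close> by simp
    then show ?thesis using t Suc.prems(5) by blast
  next
    case False
    then have "card (J - {i}) > 0" using Suc.hyps(2) Suc.prems(1,7) by simp
    then obtain l where l: "l \<in> J" "l \<noteq> i" by (metis DiffE card_gt_0_iff ex_in_conv insertI1)
    \<comment> \<open>The option type adjoins the exponent \<open>M\<close>, as \<open>None\<close>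
      with coefficient \<open>- \<beta>\<close>, which turns the interpolation identity into a sum
      with zeros in \<open>T\<close>. The Rolle step then replaces \<open>\<beta>\<close> by
      \<open>\<beta> * (M - e l)\<close>.\<close>
    let ?O = "insert None (Some ` J)"
    let ?e = "case_option M e" and ?b = "case_option (- \<beta>) b"
    have opt: "(\<Sum>j\<in>?O. d j * exp (?e j * t)) = d None * exp (M * t) +
        (\<Sum>j\<in>J. d (Some j) * exp (e j * t))" for d t
      using Suc.prems(1) by (simp add: sum.reindex image_iff)
    have "\<forall>t\<in>T. (\<Sum>j\<in>?O. ?b j * exp (?e j * t)) = 0"
      using Suc.prems(6) unfolding opt by simp
    from exp_sum_Rolle[OF Suc.prems(3) Tne Suc.prems(5) this, of "e l"]
    obtain T' where T': "finite T'" "Suc (card T') = card T" "T' \<subseteq> {lo..hi}"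
      "\<forall>t\<in>T'. (\<Sum>j\<in>J. ((e j - e l) * b j) * exp (e j * t)) = \<beta> * (M - e l) * exp (M * t)"
      unfolding opt by (auto simp: algebra_simps)
    have "\<exists>\<xi>\<in>{lo..hi}. (e i - e l) * b i =
        \<beta> * (M - e l) * node_ratio e M (J - {l}) i * exp ((M - e i) * \<xi>)"
    proof (rule Suc.hyps(1)[of "J - {l}" T' "\<lambda>j. (e j - e l) * b j" "\<beta> * (M - e l)"])
      show "\<forall>t\<in>T'. (\<Sum>j\<in>J - {l}. ((e j - e l) * b j) * exp (e j * t)) = \<beta> * (M - e l) * exp (M * t)"
        using T'(4) Suc.prems(1) l by (simp add: sum_diff1)
    qed (use Suc.prems Suc.hyps(2) l T' in \<open>auto intro: inj_on_diff simp: card_Diff_singleton\<close>)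
    moreover have "e i \<noteq> e l" using Suc.prems(2,7) l by (auto dest: inj_onD)
    ultimately show ?thesis using l Suc.prems(1)
      by (auto simp: node_ratio_remove[of J l i] field_simps)
  qed
qed

section \<open>Positive semidefinite matrices and the Schur product\<close>

text \<open>Functions on indices instead of matrices: the dimension can vary in inductions while
  \<open>A\<close> stays the same, and entries beyond \<open>n\<close> are ignored.\<close>

definition psd_fun :: "nat \<Rightarrow> (nat \<Rightarrow> nat \<Rightarrow> real) \<Rightarrow> bool" where
  "psd_fun n A \<longleftrightarrow> (\<forall>i<n. \<forall>j<n. A i j = A j i) \<and> (\<forall>v. 0 \<le> (\<Sum>i<n. \<Sum>j<n. v i * v j * A i j))"

lemma psd_funI:
  assumes "\<And>i j. i < n \<Longrightarrow> j < n \<Longrightarrow> A i j = A j i"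
    and "\<And>v. 0 \<le> (\<Sum>i<n. \<Sum>j<n. v i * v j * A i j)"
  shows "psd_fun n A"
  using assms by (auto simp: psd_fun_def)

lemma psd_fun_sym: "psd_fun n A \<Longrightarrow> i < n \<Longrightarrow> j < n \<Longrightarrow> A i j = A j i"
  by (auto simp: psd_fun_def)

lemma psd_fun_quad: "psd_fun n A \<Longrightarrow> 0 \<le> (\<Sum>i<n. \<Sum>j<n. v i * v j * A i j)"
  by (auto simp: psd_fun_def)

lemma psd_fun_cong:
  assumes "\<And>i j. i < n \<Longrightarrow> j < n \<Longrightarrow> A i j = B i j"
  shows "psd_fun n A \<longleftrightarrow> psd_fun n B"
proof -
  have "(\<Sum>i<n. \<Sum>j<n. v i * v j * A i j) = (\<Sum>i<n. \<Sum>j<n. v i * v j * B i j)" for v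
    using assms by (intro sum.cong refl) auto
  then show ?thesis unfolding psd_fun_def using assms by auto
qed

lemma psd_fun_restrict:
  assumes "psd_fun n A" "m \<le> n"
  shows "psd_fun m A"
proof (rule psd_funI)
  fix v :: "nat \<Rightarrow> real"
  let ?w = "\<lambda>i. if i < m then v i else 0"
  have "(\<Sum>i<m. \<Sum>j<m. v i * v j * A i j) = (\<Sum>i<n. \<Sum>j<n. ?w i * ?w j * A i j)"
    using assms(2)
    by (intro sum.mono_neutral_cong_left) (auto intro!: sum.mono_neutral_cong_left)
  then show "0 \<le> (\<Sum>i<m. \<Sum>j<m. v i * v j * A i j)"
    using psd_fun_quad[OF assms(1)] by simp
qed (use assms in \<open>auto simp: psd_fun_def\<close>)

lemma psd_fun_add:
  assumes "psd_fun n A" "psd_fun n B"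
  shows "psd_fun n (\<lambda>i j. A i j + B i j)"
  using assms by (auto simp: psd_fun_def distrib_left sum.distrib intro: add_nonneg_nonneg)

lemma psd_fun_scale:
  assumes "psd_fun n A" "0 \<le> c"
  shows "psd_fun n (\<lambda>i j. c * A i j)"
proof (rule psd_funI)
  fix v :: "nat \<Rightarrow> real"
  have "(\<Sum>i<n. \<Sum>j<n. v i * v j * (c * A i j)) = c * (\<Sum>i<n. \<Sum>j<n. v i * v j * A i j)"
    by (simp add: sum_distrib_left algebra_simps)
  then show "0 \<le> (\<Sum>i<n. \<Sum>j<n. v i * v j * (c * A i j))"
    using psd_fun_quad[OF assms(1)] assms(2) by simp
qed (use assms in \<open>auto simp: psd_fun_def\<close>)

lemma quad_rank_one:
  fixes v u :: "nat \<Rightarrow> real"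
  shows "(\<Sum>i<n. \<Sum>j<n. v i * v j * (u i * u j)) = (\<Sum>i<n. v i * u i)\<^sup>2"
  by (simp add: power2_eq_square sum_product algebra_simps)

lemma psd_fun_rank_one: "psd_fun n (\<lambda>i j. u i * u j)"
  by (rule psd_funI) (auto simp: quad_rank_one)

lemma quad_Suc:
  fixes v :: "nat \<Rightarrow> real"
  assumes "\<And>i. i < n \<Longrightarrow> A i n = A n i"
  shows "(\<Sum>i<Suc n. \<Sum>j<Suc n. v i * v j * A i j) =
    (\<Sum>i<n. \<Sum>j<n. v i * v j * A i j) + 2 * v n * (\<Sum>i<n. v i * A i n) + (v n)\<^sup>2 * A n n"
proof -
  have "(\<Sum>i<n. v n * v i * A n i) = v n * (\<Sum>i<n. v i * A i n)"
    using assms by (simp add: sum_distrib_left mult.assoc)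
  moreover have "(\<Sum>i<n. v i * v n * A i n) = v n * (\<Sum>i<n. v i * A i n)"
    by (simp add: sum_distrib_left algebra_simps)
  ultimately show ?thesis
    by (simp add: sum.distrib power2_eq_square)
qed

lemma sum_of_bool_eq:
  fixes g :: "nat \<Rightarrow> real"
  assumes "k < n"
  shows "(\<Sum>i<n. of_bool (i = k) * g i) = g k"
  using sum.mono_neutral_right[of "{..<n}" "{k}" "\<lambda>i. of_bool (i = k) * g i"] assms by simp

lemma quad_of_bool_eq:
  fixes A :: "nat \<Rightarrow> nat \<Rightarrow> real"
  assumes "k < n"
  shows "(\<Sum>i<n. \<Sum>j<n. of_bool (i = k) * of_bool (j = k) * A i j) = A k k"
  unfolding mult.assoc sum_distrib_left[symmetric] sum_of_bool_eq[OF assms] ..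

lemma psd_fun_diag: "psd_fun n A \<Longrightarrow> k < n \<Longrightarrow> 0 \<le> A k k"
  using psd_fun_quad[of n A "\<lambda>i. of_bool (i = k)"] by (simp add: quad_of_bool_eq)

text \<open>With \<open>A n n = 0\<close> the form is affine in the last coordinate, so it is
  bounded below only if the mixed terms vanish.\<close>

lemma psd_fun_diag_zero:
  assumes psd: "psd_fun (Suc n) A" and "A n n = 0" "k < n"
  shows "A k n = 0"
proof (rule ccontr)
  assume ne: "A k n \<noteq> 0"
  \<comment> \<open>The coordinate \<open>v n\<close> is chosen so that the form takes the value
    \<open>A k k - (A k k + 1) = -1\<close>.\<close>
  define v where "v i = (if i = k then 1 else if i = n then - (A k k + 1) / (2 * A k n) else 0)" for i
  have sym: "A i n = A n i" if "i < n" for i using psd that by (auto simp: psd_fun_def)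
  have vn: "v i = of_bool (i = k)" if "i < n" for i using that by (simp add: v_def)
  have "(\<Sum>i<n. \<Sum>j<n. v i * v j * A i j) = (\<Sum>i<n. \<Sum>j<n. (of_bool (i = k)) * of_bool (j = k) * A i j)"
    by (intro sum.cong refl) (simp add: vn)
  also have "\<dots> = A k k"
    using \<open>k < n\<close> by (rule quad_of_bool_eq)
  finally have 1: "(\<Sum>i<n. \<Sum>j<n. v i * v j * A i j) = A k k" .
  have "(\<Sum>i<n. v i * A i n) = (\<Sum>i<n. of_bool (i = k) * A i n)"
    by (intro sum.cong refl) (simp add: vn)
  also have "\<dots> = A k n"
    using \<open>k < n\<close> by (rule sum_of_bool_eq)
  finally have 2: "(\<Sum>i<n. v i * A i n) = A k n" .
  have "2 * v n * A k n = - (A k k + 1)" using ne \<open>k < n\<close> by (simp add: v_def)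
  then have "(\<Sum>i<Suc n. \<Sum>j<Suc n. v i * v j * A i j) = -1"
    using quad_Suc[where n = n and A = A and v = v, OF sym] 1 2 assms by simp
  then show False using psd_fun_quad[OF psd, of v] by simp
qed

text \<open>If the last diagonal entry vanishes then so does its row, and division by zero subtracts
  nothing.\<close>

lemma psd_fun_Schur_complement:
  assumes psd: "psd_fun (Suc n) A"
  shows "psd_fun n (\<lambda>i j. A i j - A i n * A j n / A n n)"
proof (rule psd_funI)
  fix v :: "nat \<Rightarrow> real"
  let ?s = "\<Sum>i<n. v i * A i n"
  have sym: "A i n = A n i" if "i < n" for i using psd that by (auto simp: psd_fun_def)
  \<comment> \<open>For \<open>A n n > 0\<close> this last coordinate minimises the form with the
    others fixed; completing the square leaves \<open>- ?s\<^sup>2 / A n n\<close>.\<close>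
  define w where "w = v(n := - ?s / A n n)"
  have wn: "w i = v i" if "i < n" for i using that by (simp add: w_def)
  have "(\<Sum>i<Suc n. \<Sum>j<Suc n. w i * w j * A i j) =
      (\<Sum>i<n. \<Sum>j<n. v i * v j * A i j) + (2 * w n * ?s + (w n)\<^sup>2 * A n n)"
  proof -
    have "(\<Sum>i<n. \<Sum>j<n. w i * w j * A i j) = (\<Sum>i<n. \<Sum>j<n. v i * v j * A i j)"
      "(\<Sum>i<n. w i * A i n) = ?s"
      by (intro sum.cong refl; simp add: wn)+
    then show ?thesis using quad_Suc[where n = n and A = A and v = w, OF sym] by simp
  qed
  also have "2 * w n * ?s + (w n)\<^sup>2 * A n n = - ?s\<^sup>2 / A n n"
    by (cases "A n n = 0") (auto simp: w_def power2_eq_square field_simps)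
  finally have "0 \<le> (\<Sum>i<n. \<Sum>j<n. v i * v j * A i j) - ?s\<^sup>2 / A n n"
    using psd_fun_quad[OF psd, of w] by simp
  also have "?s\<^sup>2 = (\<Sum>i<n. \<Sum>j<n. v i * v j * (A i n * A j n))"
    by (simp add: quad_rank_one[of v "\<lambda>i. A i n"])
  finally show "0 \<le> (\<Sum>i<n. \<Sum>j<n. v i * v j * (A i j - A i n * A j n / A n n))"
    by (simp add: right_diff_distrib sum_subtractf sum_divide_distrib)
qed (use psd in \<open>auto simp: psd_fun_def\<close>)

text \<open>Splitting off the last column, \<open>A\<close> is the sum of \<open>R\<close> and a
  rank one matrix. The rank one part contributes the form of \<open>B\<close> at the vector
  \<open>v i * A i n\<close>, divided by \<open>A n n\<close>; \<open>R\<close> is supported on the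
  leading block, where the induction hypothesis applies.\<close>

lemma psd_fun_Schur_product:
  assumes "psd_fun n A" "psd_fun n B"
  shows "psd_fun n (\<lambda>i j. A i j * B i j)"
  using assms
proof (induction n arbitrary: A B)
  case 0
  then show ?case by (simp add: psd_fun_def)
next
  case (Suc n)
  define R where "R i j = A i j - A i n * A j n / A n n" for i j
  have sym: "A i j = A j i" if "i \<le> n" "j \<le> n" for i j using Suc.prems(1) that by (auto simp: psd_fun_def)
  have R0: "R i n = 0" "R n i = 0" if "i \<le> n" for i
    using psd_fun_diag_zero[OF Suc.prems(1), of i] that sym[of i n]
    by (cases "A n n = 0"; cases "i = n"; force simp: R_def field_simps)+
  have "psd_fun n B" using Suc.prems(2) by (rule psd_fun_restrict) simp
  then have RB: "psd_fun n (\<lambda>i j. R i j * B i j)"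
    using Suc.IH psd_fun_Schur_complement[OF Suc.prems(1)] by (simp add: R_def)
  show ?case
  proof (rule psd_funI)
    fix v :: "nat \<Rightarrow> real"
    have "(\<Sum>i<Suc n. \<Sum>j<Suc n. v i * v j * (A i j * B i j)) =
       (\<Sum>i<Suc n. \<Sum>j<Suc n. v i * v j * (R i j * B i j)) +
       (\<Sum>i<Suc n. \<Sum>j<Suc n. (v i * A i n) * (v j * A j n) * B i j) / A n n"
      unfolding R_def sum_divide_distrib sum.distrib[symmetric]
      by (intro sum.cong refl) (simp add: algebra_simps)
    moreover have "(\<Sum>i<Suc n. \<Sum>j<Suc n. v i * v j * (R i j * B i j)) =
       (\<Sum>i<n. \<Sum>j<n. v i * v j * (R i j * B i j))"
      using R0 by (simp add: less_imp_le)
    ultimately show "0 \<le> (\<Sum>i<Suc n. \<Sum>j<Suc n. v i * v j * (A i j * B i j))"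
      using psd_fun_quad[OF RB, of v] psd_fun_quad[OF Suc.prems(2), of "\<lambda>i. v i * A i n"]
        psd_fun_diag[OF Suc.prems(1), of n] by simp
  qed (use Suc.prems in \<open>auto simp: psd_fun_def\<close>)
qed

section \<open>Entrywise preservers\<close>

definition psd_on :: "nat \<Rightarrow> real \<Rightarrow> (nat \<Rightarrow> nat \<Rightarrow> real) \<Rightarrow> bool" where
  "psd_on n \<rho> A \<longleftrightarrow> psd_fun n A \<and> (\<forall>i<n. \<forall>j<n. 0 < A i j \<and> A i j < \<rho>)"

definition preserves :: "nat \<Rightarrow> real \<Rightarrow> (real \<Rightarrow> real) \<Rightarrow> bool" where
  "preserves n \<rho> f \<longleftrightarrow> (\<forall>A. psd_on n \<rho> A \<longrightarrow> psd_fun n (\<lambda>i j. f (A i j)))"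

text \<open>Bridge between the matrices of the statement and index functions; the arguments below
  work with \<open>preserves\<close> alone.\<close>

lemma preserves_PSD_iff:
  "preserves n \<rho> f \<longleftrightarrow> (\<forall>A \<in> PSD n {0<..<\<rho>}. psd_mat n (map_mat f A))"
proof -
  have psd_mat_iff: "psd_mat n A \<longleftrightarrow> A \<in> carrier_mat n n \<and> psd_fun n (\<lambda>i j. A $$ (i, j))" for A
  proof (cases "A \<in> carrier_mat n n")
    case True
    have quad: "v \<bullet> (A *\<^sub>v v) = (\<Sum>i<n. \<Sum>j<n. vec_index v i * vec_index v j * A $$ (i, j))"
      if "v \<in> carrier_vec n" for v
      using True that
      by (simp add: scalar_prod_def sum_distrib_left atLeast0LessThan algebra_simps)
    have sym: "transpose_mat A = A \<longleftrightarrow> (\<forall>i<n. \<forall>j<n. A $$ (i, j) = A $$ (j, i))"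
      using True by (auto simp: mat_eq_iff)
    have "(\<forall>v\<in>carrier_vec n. 0 \<le> v \<bullet> (A *\<^sub>v v)) \<longleftrightarrow>
        (\<forall>v. 0 \<le> (\<Sum>i<n. \<Sum>j<n. v i * v j * A $$ (i, j)))" (is "?L = ?R")
    proof
      assume ?L
      show ?R
      proof
        fix v :: "nat \<Rightarrow> real"
        have "0 \<le> Matrix.vec n v \<bullet> (A *\<^sub>v Matrix.vec n v)" using \<open>?L\<close> by simp
        then show "0 \<le> (\<Sum>i<n. \<Sum>j<n. v i * v j * A $$ (i, j))" by (simp add: quad)
      qed
    qed (simp add: quad)
    with True sym show ?thesis by (simp add: psd_mat_def psd_fun_def)
  qed (simp add: psd_mat_def)
  show ?thesis
  proof (intro iffI ballI)
    fix A assume f: "preserves n \<rho> f" and A: "A \<in> PSD n {0<..<\<rho>}"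
    then have "psd_on n \<rho> (\<lambda>i j. A $$ (i, j))" "A \<in> carrier_mat n n"
      by (auto simp: PSD_def psd_mat_iff psd_on_def)
    then have "psd_fun n (\<lambda>i j. map_mat f A $$ (i, j)) \<longleftrightarrow> psd_fun n (\<lambda>i j. f (A $$ (i, j)))"
      by (intro psd_fun_cong) auto
    with f \<open>psd_on n \<rho> _\<close> \<open>A \<in> carrier_mat n n\<close> show "psd_mat n (map_mat f A)"
      by (auto simp: preserves_def psd_mat_iff)
  next
    assume f: "\<forall>A\<in>PSD n {0<..<\<rho>}. psd_mat n (map_mat f A)"
    show "preserves n \<rho> f" unfolding preserves_def
    proof (intro allI impI)
      fix A assume A: "psd_on n \<rho> A"
      let ?A = "mat n n (\<lambda>(i, j). A i j)"
      have "psd_fun n (\<lambda>i j. ?A $$ (i, j)) \<longleftrightarrow> psd_fun n A" by (intro psd_fun_cong) auto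
      with A have "?A \<in> PSD n {0<..<\<rho>}" by (auto simp: PSD_def psd_mat_iff psd_on_def)
      with f have "psd_fun n (\<lambda>i j. map_mat f ?A $$ (i, j))" by (simp add: psd_mat_iff)
      then show "psd_fun n (\<lambda>i j. f (A i j))" by (subst (asm) psd_fun_cong) auto
    qed
  qed
qed

lemma preserves_cong:
  assumes "\<And>x. 0 < x \<Longrightarrow> x < \<rho> \<Longrightarrow> f x = g x"
  shows "preserves n \<rho> f \<longleftrightarrow> preserves n \<rho> g"
proof -
  have "psd_fun n (\<lambda>i j. f (A i j)) \<longleftrightarrow> psd_fun n (\<lambda>i j. g (A i j))" if "psd_on n \<rho> A" for A
    using that by (intro psd_fun_cong) (auto simp: psd_on_def assms)
  then show ?thesis by (simp add: preserves_def)
qed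

lemma preserves_add: "preserves n \<rho> f \<Longrightarrow> preserves n \<rho> g \<Longrightarrow> preserves n \<rho> (\<lambda>x. f x + g x)"
  by (simp add: preserves_def psd_fun_add)

lemma preserves_scale: "preserves n \<rho> f \<Longrightarrow> 0 \<le> c \<Longrightarrow> preserves n \<rho> (\<lambda>x. c * f x)"
  by (simp add: preserves_def psd_fun_scale)

lemma preserves_zero: "preserves n \<rho> (\<lambda>x. 0)"
  by (simp add: preserves_def psd_fun_def)

lemma preserves_sum:
  "(\<And>j. j \<in> J \<Longrightarrow> preserves n \<rho> (f j)) \<Longrightarrow> preserves n \<rho> (\<lambda>x. \<Sum>j\<in>J. f j x)"
  by (induction J rule: infinite_finite_induct) (auto intro: preserves_add preserves_zero)

lemma preserves_0: "preserves 0 \<rho> f"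
  by (simp add: preserves_def psd_fun_def)

lemma preserves_power: "preserves n \<rho> (\<lambda>x. x ^ k)"
proof (induction k)
  case 0
  then show ?case using psd_fun_rank_one[of n "\<lambda>i. 1"] by (simp add: preserves_def)
next
  case (Suc k)
  then show ?case by (auto simp: preserves_def psd_on_def intro: psd_fun_Schur_product)
qed

text \<open>FitzGerald--Horn: with \<open>u\<^sub>i = a\<^sub>i\<^sub>n / sqrt a\<^sub>n\<^sub>n\<close>, the path
  from \<open>u u\<^sup>T\<close> to \<open>A\<close> moves in the direction of the Schur complement, whose last row and column vanish.\<close>

lemma preserves_Suc:
  assumes der: "\<And>x. 0 < x \<Longrightarrow> x < \<rho> \<Longrightarrow> (f has_real_derivative f' x) (at x)"
    and f': "preserves n \<rho> f'"
    and rank_one: "\<And>u. (\<And>i. i \<le> n \<Longrightarrow> 0 < u i) \<Longrightarrow> (\<And>i j. i \<le> n \<Longrightarrow> j \<le> n \<Longrightarrow> u i * u j < \<rho>)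
      \<Longrightarrow> psd_fun (Suc n) (\<lambda>i j. f (u i * u j))"
  shows "preserves (Suc n) \<rho> f"
  unfolding preserves_def
proof (intro allI impI psd_funI)
  fix A i j assume "psd_on (Suc n) \<rho> A" "i < Suc n" "j < Suc n"
  then show "f (A i j) = f (A j i)" using psd_fun_sym by (metis psd_on_def)
next
  fix A :: "nat \<Rightarrow> nat \<Rightarrow> real" and v assume A: "psd_on (Suc n) \<rho> A"
  then have pos: "0 < A i j" and lt: "A i j < \<rho>"
    if "i \<le> n" "j \<le> n" for i j
    using that by (auto simp: psd_on_def)
  have psd: "psd_fun (Suc n) A" using A by (simp add: psd_on_def)
  define u where "u i = A i n / sqrt (A n n)" for i
  have uu: "u i * u j = A i n * A j n / A n n" for i j using pos[of n n] by (simp add: u_def)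
  have u_pos: "0 < u i" if "i \<le> n" for i using pos that by (simp add: u_def)
  have uu_eq: "u i * u n = A i n" "u n * u i = A i n" for i using pos[of n n] by (simp_all add: uu)
  have psd_R: "psd_fun n (\<lambda>i j. A i j - u i * u j)"
    using psd_fun_Schur_complement[OF psd] by (simp add: uu)
  \<comment> \<open>The diagonal of the Schur complement is nonnegative, which gives
    \<open>u i * u i \<le> A i i\<close>. With the inequality of arithmetic and geometric means, all
    entries \<open>u i * u j\<close> of the starting matrix stay below
    \<open>\<rho>\<close>.\<close>
  have u_sq: "u i * u i < \<rho>" if "i \<le> n" for i
  proof (cases "i = n")
    case False
    then have "u i * u i \<le> A i i" using psd_fun_diag[OF psd_R, of i] that by simp
    then show ?thesis using lt[of i i] that by simp
  qed (use uu_eq lt in auto)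
  have u_lt: "u i * u j < \<rho>" if "i \<le> n" "j \<le> n" for i j
  proof -
    have "2 * (u i * u j) \<le> u i * u i + u j * u j"
      using zero_le_power2[of "u i - u j"] by (simp add: power2_eq_square algebra_simps)
    then show ?thesis using u_sq[of i] u_sq[of j] that by simp
  qed
  define B where "B s i j = u i * u j + s * (A i j - u i * u j)" for s i j
  define R where "R i j = A i j - u i * u j" for i j
  have B_mem: "0 < B s i j" "B s i j < \<rho>" if "i \<le> n" "j \<le> n" "0 \<le> s" "s \<le> 1" for s i j
  proof -
    have eq: "B s i j = (1 - s) * (u i * u j) + s * A i j" by (simp add: B_def algebra_simps)
    show "0 < B s i j" unfolding eq using that u_pos[of i] u_pos[of j] pos[of i j]
      by (cases "s = 1") (auto intro!: add_pos_nonneg)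
    show "B s i j < \<rho>" unfolding eq using that u_lt[of i j] lt[of i j]
      by (intro convex_bound_lt) auto
  qed
  have B_psd: "psd_on n \<rho> (B s)" if "0 \<le> s" "s \<le> 1" for s
    using B_mem that psd_fun_add[OF psd_fun_rank_one[of n u] psd_fun_scale[OF psd_R that(1)]]
    by (auto simp: psd_on_def B_def[abs_def])
  define \<phi> where "\<phi> s = (\<Sum>i<Suc n. \<Sum>j<Suc n. v i * v j * f (B s i j))" for s
  define \<phi>' where "\<phi>' s = (\<Sum>i<Suc n. \<Sum>j<Suc n. v i * v j * (f' (B s i j) * R i j))" for s
  have "(\<phi> has_real_derivative \<phi>' s) (at s)" if "0 \<le> s" "s \<le> 1" for s
    unfolding \<phi>_def \<phi>'_def
  proof (intro DERIV_sum DERIV_cmult)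
    fix i j assume "i \<in> {..<Suc n}" "j \<in> {..<Suc n}"
    then have "(f has_real_derivative f' (B s i j)) (at (B s i j))"
      using B_mem[of i j s] that by (intro der) auto
    moreover have "((\<lambda>s. B s i j) has_real_derivative R i j) (at s)"
      unfolding B_def R_def by (auto intro!: derivative_eq_intros)
    ultimately show "((\<lambda>s. f (B s i j)) has_real_derivative f' (B s i j) * R i j) (at s)"
      by (rule DERIV_chain2)
  qed
  \<comment> \<open>The derivative is the form of the Schur product of \<open>f'[B s]\<close> and
    \<open>R\<close> on the leading block, so dimension \<open>n\<close> suffices for
    \<open>f'\<close>.\<close>
  moreover have "0 \<le> \<phi>' s" if "0 \<le> s" "s \<le> 1" for s
  proof -
    have R0: "R i n = 0" "R n i = 0" if "i \<le> n" for i
      using uu_eq psd_fun_sym[OF psd, of i n] that by (auto simp: R_def)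
    have "psd_fun n (\<lambda>i j. f' (B s i j) * R i j)"
      using f' B_psd[OF that] psd_R by (auto simp: preserves_def R_def intro: psd_fun_Schur_product)
    moreover have "\<phi>' s = (\<Sum>i<n. \<Sum>j<n. v i * v j * (f' (B s i j) * R i j))"
      unfolding \<phi>'_def using R0 by (simp add: less_imp_le)
    ultimately show ?thesis using psd_fun_quad by simp
  qed
  ultimately have "\<phi> 0 \<le> \<phi> 1" by (intro DERIV_nonneg_imp_nondecreasing[of 0 1 \<phi>]) auto
  moreover have "0 \<le> \<phi> 0"
    using psd_fun_quad[OF rank_one[of u], of v] u_pos u_lt by (simp add: \<phi>_def B_def)
  ultimately show "0 \<le> (\<Sum>i<Suc n. \<Sum>j<Suc n. v i * v j * f (A i j))"
    by (simp add: \<phi>_def B_def)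
qed

text \<open>Natural exponents are iterated Schur products. For real \<open>a \<ge> n - 2\<close>
  differentiation lowers both the exponent and the dimension by one, which keeps the bound.\<close>

lemma preserves_powr:
  assumes "a \<in> admissible_powers n"
  shows "preserves n \<rho> (\<lambda>x. x powr a)"
proof -
  \<comment> \<open>In dimension at most 1 every exponent is allowed, which gives the induction its
    base; from dimension 2 on the bound makes the factor \<open>a\<close> of the derivative
    nonnegative.\<close>
  have real_case: "preserves n \<rho> (\<lambda>x. x powr a)" if "real n - 2 \<le> a \<or> n \<le> 1" for a
    using that
  proof (induction n arbitrary: a)
    case 0
    show ?case by (rule preserves_0)
  next
    case (Suc n)
    show ?case
    proof (rule preserves_Suc[where f' = "\<lambda>x. a * x powr (a - 1)"])
      show "((\<lambda>x. x powr a) has_real_derivative a * x powr (a - 1)) (at x)" if "0 < x" for x :: real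
        using that by (rule has_real_derivative_powr)
      show "preserves n \<rho> (\<lambda>x. a * x powr (a - 1))"
      proof (cases "n = 0")
        case False
        then show ?thesis using Suc by (intro preserves_scale Suc.IH) auto
      qed (simp add: preserves_0)
      show "psd_fun (Suc n) (\<lambda>i j. (u i * u j) powr a)" if "\<And>i. i \<le> n \<Longrightarrow> 0 < u i" for u
      proof -
        have "psd_fun (Suc n) (\<lambda>i j. (u i * u j) powr a) \<longleftrightarrow>
            psd_fun (Suc n) (\<lambda>i j. u i powr a * u j powr a)"
          using that by (intro psd_fun_cong powr_mult)
        then show ?thesis using psd_fun_rank_one by simp
      qed
    qed
  qed
  show ?thesis
  proof (cases "a \<in> \<nat>")
    case True
    then obtain k where "a = real k" by (auto elim: Nats_cases)
    then have "preserves n \<rho> (\<lambda>x. x powr a) \<longleftrightarrow> preserves n \<rho> (\<lambda>x. x ^ k)"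
      by (intro preserves_cong) (simp add: powr_realpow)
    then show ?thesis by (simp add: preserves_power)
  next
    case False
    then show ?thesis using assms by (intro real_case) (auto simp: admissible_powers_def)
  qed
qed

section \<open>Sufficiency of the threshold\<close>

text \<open>Each entrywise power of the matrix with entries \<open>exp (t i) * exp (t j)\<close> has
  rank one, so the form becomes diagonal in the moments of \<open>v\<close>.\<close>

lemma quad_exp_sum:
  fixes t v :: "nat \<Rightarrow> real"
  assumes "\<And>i j. i < n \<Longrightarrow> j < n \<Longrightarrow> f (exp (t i) * exp (t j)) = (\<Sum>r\<in>R. c r * (exp (t i) * exp (t j)) powr e r)"
  shows "(\<Sum>i<n. \<Sum>j<n. v i * v j * f (exp (t i) * exp (t j))) =
    (\<Sum>r\<in>R. c r * (\<Sum>i<n. v i * exp (e r * t i))\<^sup>2)"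
proof -
  have pw: "(exp (t i) * exp (t j)) powr a = exp (a * t i) * exp (a * t j)" for i j and a :: real
    by (simp add: powr_def algebra_simps flip: exp_add)
  have "(\<Sum>i<n. \<Sum>j<n. v i * v j * f (exp (t i) * exp (t j))) =
      (\<Sum>i<n. \<Sum>j<n. \<Sum>r\<in>R. c r * (v i * v j * (exp (e r * t i) * exp (e r * t j))))"
    by (intro sum.cong refl) (simp add: assms pw sum_distrib_left algebra_simps)
  also have "\<dots> = (\<Sum>i<n. \<Sum>r\<in>R. \<Sum>j<n. c r * (v i * v j * (exp (e r * t i) * exp (e r * t j))))"
    by (intro sum.cong refl sum.swap)
  also have "\<dots> = (\<Sum>r\<in>R. \<Sum>i<n. \<Sum>j<n. c r * (v i * v j * (exp (e r * t i) * exp (e r * t j))))"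
    by (rule sum.swap)
  also have "\<dots> = (\<Sum>r\<in>R. c r * (\<Sum>i<n. v i * exp (e r * t i))\<^sup>2)"
    by (simp add: sum_distrib_left[symmetric] quad_rank_one)
  finally show ?thesis .
qed

lemma weighted_Cauchy_Schwarz:
  fixes b c y :: "'j \<Rightarrow> real"
  assumes "\<And>j. j \<in> J \<Longrightarrow> 0 < c j"
  shows "(\<Sum>j\<in>J. b j * y j)\<^sup>2 \<le> (\<Sum>j\<in>J. (b j)\<^sup>2 / c j) * (\<Sum>j\<in>J. c j * (y j)\<^sup>2)"
proof -
  have "(\<Sum>j\<in>J. b j * y j) = (\<Sum>j\<in>J. (b j / sqrt (c j)) * (sqrt (c j) * y j))"
    using assms by (intro sum.cong) (auto simp: less_imp_neq[symmetric])
  also have "\<dots>\<^sup>2 \<le> (\<Sum>j\<in>J. (b j / sqrt (c j))\<^sup>2) * (\<Sum>j\<in>J. (sqrt (c j) * y j)\<^sup>2)"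
    by (rule Cauchy_Schwarz_ineq_sum)
  also have "\<dots> = (\<Sum>j\<in>J. (b j)\<^sup>2 / c j) * (\<Sum>j\<in>J. c j * (y j)\<^sup>2)"
    using assms by (intro arg_cong2[where f = "(*)"] sum.cong)
      (auto simp: power_divide power_mult_distrib less_imp_le)
  finally show ?thesis .
qed

text \<open>The threshold constant in terms of \<open>node_ratio\<close>. The index set is arbitrary
  because the induction over dimensions deletes exponents.\<close>

definition ratio_const :: "'j set \<Rightarrow> ('j \<Rightarrow> real) \<Rightarrow> real \<Rightarrow> ('j \<Rightarrow> real) \<Rightarrow> real \<Rightarrow> real" where
  "ratio_const J e M c \<rho> = (\<Sum>j\<in>J. (node_ratio e M J j)\<^sup>2 * (\<rho> powr (M - e j) / c j))"

text \<open>All nodes lie below \<open>\<tau>\<close>, half the logarithm of \<open>\<rho>\<close>.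
  The mean value form thus bounds \<open>(b j)\<^sup>2\<close> by its value at
  \<open>\<xi> = \<tau>\<close>, and weighted Cauchy--Schwarz bounds \<open>(y M)\<^sup>2\<close> by
  \<open>ratio_const J e M c \<rho> * ?Q\<close>.\<close>

lemma rank_one_below_threshold:
  fixes c e :: "'j \<Rightarrow> real"
  assumes J: "finite J" "card J = n" "inj_on e J" "\<And>j. j \<in> J \<Longrightarrow> e j < M" "\<And>j. j \<in> J \<Longrightarrow> 0 < c j"
    and "\<rho> > 0" and c': "c' \<le> 0" "- c' * ratio_const J e M c \<rho> \<le> 1"
    and u: "\<And>i. i < n \<Longrightarrow> 0 < u i" "\<And>i j. i < n \<Longrightarrow> j < n \<Longrightarrow> u i * u j < \<rho>"
  shows "psd_fun n (\<lambda>i j. (\<Sum>r\<in>J. c r * (u i * u j) powr e r) + c' * (u i * u j) powr M)"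
proof (rule psd_funI)
  fix v :: "nat \<Rightarrow> real"
  define \<tau> where "\<tau> = ln \<rho> / 2"
  define t where "t i = ln (u i)" for i
  have ut: "u i = exp (t i)" if "i < n" for i using u(1)[OF that] by (simp add: t_def)
  have t_less: "t i < \<tau>" if "i < n" for i
  proof -
    have "exp (t i + t i) < exp (ln \<rho>)"
      unfolding exp_add using u(2)[OF that that] ut[OF that] \<open>\<rho> > 0\<close> by (simp only: exp_ln)
    then show ?thesis by (simp add: \<tau>_def)
  qed
  \<comment> \<open>The \<open>t i\<close> may coincide, so further points below
    \<open>\<tau>\<close> fill the node set up to exactly \<open>n\<close> elements.\<close>
  obtain T where T: "t ` {..<n} \<subseteq> T" "finite T" "card T = n" "T \<subseteq> {..<\<tau>}"
  proof -
    obtain T' where T': "T' \<subseteq> {..<\<tau>} - t ` {..<n}" "finite T'" "card T' = n - card (t ` {..<n})"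
      using infinite_arbitrarily_large[of "{..<\<tau>} - t ` {..<n}" "n - card (t ` {..<n})"] infinite_Iio by auto
    have "card (t ` {..<n} \<union> T') = card (t ` {..<n}) + card T'"
      using T' by (intro card_Un_disjoint) auto
    also have "\<dots> = n" using card_image_le[of "{..<n}" t] T'(3) by simp
    finally show ?thesis using T' t_less by (intro that[of "t ` {..<n} \<union> T'"]) auto
  qed
  obtain b where b: "\<forall>x\<in>T. (\<Sum>j\<in>J. b j * exp (e j * x)) = exp (M * x)"
    using exp_sum_interpolation[of T J e "\<lambda>x. x" "\<lambda>x. exp (M * x)"] T J by auto
  have b_le: "(b j)\<^sup>2 \<le> (node_ratio e M J j)\<^sup>2 * \<rho> powr (M - e j)" if "j \<in> J" for j
  proof -
    have "T \<subseteq> {Min T..\<tau>}" using T(2,4) by (auto intro: less_imp_le)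
    then have "\<exists>\<xi>\<in>{Min T..\<tau>}. b j = 1 * node_ratio e M J j * exp ((M - e j) * \<xi>)"
      using J(1-3) T b that by (intro exp_interpolation_coeff[where T = T]) auto
    then obtain \<xi> where \<xi>: "\<xi> \<le> \<tau>" "b j = node_ratio e M J j * exp ((M - e j) * \<xi>)"
      by auto
    have "(exp ((M - e j) * \<xi>))\<^sup>2 \<le> (exp ((M - e j) * \<tau>))\<^sup>2"
      using \<xi>(1) J(4)[OF that] by (intro power_mono) (auto simp: mult_left_mono)
    also have "\<dots> = \<rho> powr (M - e j)"
      using \<open>\<rho> > 0\<close> by (simp add: powr_def \<tau>_def power2_eq_square flip: exp_add)
    finally show ?thesis by (simp add: \<xi>(2) power_mult_distrib mult_left_mono)
  qed
  define y where "y a = (\<Sum>i<n. v i * exp (a * t i))" for a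
  have yM: "y M = (\<Sum>j\<in>J. b j * y (e j))"
  proof -
    have "y M = (\<Sum>i<n. \<Sum>j\<in>J. v i * (b j * exp (e j * t i)))"
      unfolding y_def using b T(1) by (intro sum.cong refl) (simp flip: sum_distrib_left, force)
    also have "\<dots> = (\<Sum>j\<in>J. \<Sum>i<n. v i * (b j * exp (e j * t i)))" by (rule sum.swap)
    finally show ?thesis by (simp add: y_def sum_distrib_left algebra_simps)
  qed
  let ?Q = "\<Sum>j\<in>J. c j * (y (e j))\<^sup>2"
  have Q0: "0 \<le> ?Q" using J by (intro sum_nonneg mult_nonneg_nonneg) (auto intro: less_imp_le)
  have b_div_le: "(b j)\<^sup>2 / c j \<le> (node_ratio e M J j)\<^sup>2 * (\<rho> powr (M - e j) / c j)" if "j \<in> J" for j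
    using divide_right_mono[OF b_le[OF that], of "c j"] J(5)[OF that] by simp
  have "(y M)\<^sup>2 \<le> (\<Sum>j\<in>J. (b j)\<^sup>2 / c j) * ?Q"
    unfolding yM using J by (intro weighted_Cauchy_Schwarz) auto
  also have "\<dots> \<le> ratio_const J e M c \<rho> * ?Q"
    unfolding ratio_const_def using b_div_le Q0 by (intro mult_right_mono sum_mono)
  finally have "- c' * (y M)\<^sup>2 \<le> - c' * (ratio_const J e M c \<rho> * ?Q)"
    using c'(1) by (intro mult_left_mono) auto
  also have "\<dots> \<le> 1 * ?Q" unfolding mult.assoc[symmetric] using c'(2) Q0 by (rule mult_right_mono)
  finally have main: "0 \<le> ?Q + c' * (y M)\<^sup>2" by simp
  let ?R = "insert None (Some ` J)"
  have "(\<Sum>i<n. \<Sum>j<n. v i * v j * ((\<Sum>r\<in>J. c r * (u i * u j) powr e r) + c' * (u i * u j) powr M)) =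
     (\<Sum>i<n. \<Sum>j<n. v i * v j * ((\<Sum>r\<in>J. c r * (exp (t i) * exp (t j)) powr e r)
        + c' * (exp (t i) * exp (t j)) powr M))"
    by (intro sum.cong refl) (simp add: ut)
  also have "\<dots> = (\<Sum>r\<in>?R. case_option c' c r * (\<Sum>i<n. v i * exp (case_option M e r * t i))\<^sup>2)"
    using J(1) by (intro quad_exp_sum[where f = "\<lambda>x. (\<Sum>r\<in>J. c r * x powr e r) + c' * x powr M"])
      (simp add: sum.reindex image_iff)
  also have "\<dots> = ?Q + c' * (y M)\<^sup>2"
    using J(1) by (simp add: sum.reindex image_iff y_def)
  finally show "0 \<le> (\<Sum>i<n. \<Sum>j<n. v i * v j *
      ((\<Sum>r\<in>J. c r * (u i * u j) powr e r) + c' * (u i * u j) powr M))"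
    using main by simp
qed (simp add: mult.commute)

lemma admissible_powers_pred:
  assumes "a \<in> admissible_powers (Suc n)" "0 < a"
  shows "a - 1 \<in> admissible_powers n"
proof (cases "a \<in> \<nat>")
  case True
  then obtain k where "a = real k" by (auto elim: Nats_cases)
  then have "a - 1 = real (k - 1)" using assms(2) by (cases k) auto
  then show ?thesis by (simp add: admissible_powers_def)
qed (use assms in \<open>auto simp: admissible_powers_def\<close>)

lemma admissible_powers_nonneg: "a \<in> admissible_powers n \<Longrightarrow> 2 \<le> n \<Longrightarrow> 0 \<le> a"
  by (auto simp: admissible_powers_def elim: Nats_cases)

text \<open>Dropping the smallest exponent from the derivative leaves exponents
  \<open>e j - 1\<close>, coefficients \<open>e j * c j\<close> and the last coefficient
  \<open>M * c'\<close>; the estimate transfers the threshold condition to this sum. Differences of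
  exponents are unchanged, so each summand loses exactly the factor \<open>q\<^sup>2\<close>, which
  compensates \<open>M / e j\<close>.\<close>

lemma ratio_const_derivative:
  fixes c e :: "'j \<Rightarrow> real"
  assumes J: "finite J" "inj_on e J" "\<And>j. j \<in> J \<Longrightarrow> e j < M" "\<And>j. j \<in> J \<Longrightarrow> 0 < c j"
    and k: "k \<in> J" "0 \<le> e k" "\<And>j. j \<in> J \<Longrightarrow> e k \<le> e j" and "\<rho> > 0"
  shows "M * ratio_const (J - {k}) (\<lambda>j. e j - 1) (M - 1) (\<lambda>j. e j * c j) \<rho> \<le> ratio_const J e M c \<rho>"
proof -
  have "M * ((node_ratio (\<lambda>j. e j - 1) (M - 1) (J - {k}) j)\<^sup>2 * (\<rho> powr (M - e j) / (e j * c j)))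
      \<le> (node_ratio e M J j)\<^sup>2 * (\<rho> powr (M - e j) / c j)" if j: "j \<in> J - {k}" for j
  proof -
    have "e j \<noteq> e k" using j k(1) J(2) by (auto dest: inj_onD)
    then have ek: "e k < e j" using k(3)[of j] j by simp
    have eM: "e j < M" using J j by simp
    define q where "q = (M - e k) / (e j - e k)"
    have q1: "1 \<le> q" using ek eM by (simp add: q_def)
    \<comment> \<open>Cleared of denominators, \<open>M / e j \<le> q\<close> is this inequality;
      here \<open>0 \<le> e k\<close> enters.\<close>
    have "e k * e j \<le> e k * M" using k(2) eM by (intro mult_left_mono) auto
    then have "M / e j \<le> q" using k(2) ek by (simp add: q_def field_simps)
    also have "\<dots> \<le> q\<^sup>2" using q1 by (simp add: power2_eq_square mult_le_cancel_left1)
    finally have Mq: "M / e j \<le> q\<^sup>2" .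
    let ?X = "(node_ratio e M (J - {k}) j)\<^sup>2 * (\<rho> powr (M - e j) / c j)"
    have nr: "node_ratio (\<lambda>j. e j - 1) (M - 1) (J - {k}) j = node_ratio e M (J - {k}) j"
      by (simp add: node_ratio_def)
    have "M * ((node_ratio (\<lambda>j. e j - 1) (M - 1) (J - {k}) j)\<^sup>2 * (\<rho> powr (M - e j) / (e j * c j)))
       = M / e j * ?X" unfolding nr by simp
    also have "\<dots> \<le> q\<^sup>2 * ?X" using Mq J(4)[of j] j by (intro mult_right_mono) auto
    also have "\<dots> = (node_ratio e M J j)\<^sup>2 * (\<rho> powr (M - e j) / c j)"
      using node_ratio_remove[of J k j e M, folded q_def] J(1) k(1) j by (auto simp: power_mult_distrib)
    finally show ?thesis .
  qed
  note term_le = this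
  have "M * ratio_const (J - {k}) (\<lambda>j. e j - 1) (M - 1) (\<lambda>j. e j * c j) \<rho> =
      (\<Sum>j\<in>J - {k}. M * ((node_ratio (\<lambda>j. e j - 1) (M - 1) (J - {k}) j)\<^sup>2
        * (\<rho> powr (M - e j) / (e j * c j))))"
    by (simp add: ratio_const_def sum_distrib_left)
  also have "\<dots> \<le> (\<Sum>j\<in>J - {k}. (node_ratio e M J j)\<^sup>2 * (\<rho> powr (M - e j) / c j))"
    by (intro sum_mono term_le)
  also have "\<dots> \<le> ratio_const J e M c \<rho>"
    unfolding ratio_const_def using J(1,4) by (intro sum_mono2) (auto simp: less_imp_le)
  finally show ?thesis .
qed

text \<open>FitzGerald--Horn induction on the dimension. The derivative splits into the term of
  smallest exponent, which preserves positivity on its own, and a sum of the same shape with one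
  exponent fewer, which meets its threshold by \<open>ratio_const_derivative\<close>.\<close>

lemma preserves_below_threshold:
  fixes c e :: "'j \<Rightarrow> real"
  assumes "finite J" "card J = Suc n" "inj_on e J" "\<And>j. j \<in> J \<Longrightarrow> e j < M" "\<And>j. j \<in> J \<Longrightarrow> 0 < c j"
    and "\<And>j. j \<in> J \<Longrightarrow> e j \<in> admissible_powers (Suc n)"
    and "\<rho> > 0" "c' \<le> 0" "- c' * ratio_const J e M c \<rho> \<le> 1"
  shows "preserves (Suc n) \<rho> (\<lambda>x. (\<Sum>j\<in>J. c j * x powr e j) + c' * x powr M)"
  using assms
proof (induction n arbitrary: J e M c c')
  case 0
  show ?case
    using 0 by (intro preserves_Suc[where f' = "\<lambda>x. (\<Sum>j\<in>J. c j * (e j * x powr (e j - 1))) + c' * (M * x powr (M - 1))"]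
        rank_one_below_threshold preserves_0)
      (auto intro!: derivative_eq_intros has_real_derivative_powr sum.cong)
next
  case (Suc n)
  obtain k where k: "k \<in> J" "\<And>j. j \<in> J \<Longrightarrow> e k \<le> e j"
  proof -
    have "Min (e ` J) \<in> e ` J" using Suc.prems(1,2) by (intro Min_in) auto
    then obtain k where "k \<in> J" "e k = Min (e ` J)" by auto
    then show ?thesis using that[of k] Suc.prems(1) by simp
  qed
  have ek0: "0 \<le> e k" using Suc.prems(6)[OF k(1)] admissible_powers_nonneg by simp
  have ek: "e k < e j" if "j \<in> J - {k}" for j
  proof -
    have "e j \<noteq> e k" using that k(1) Suc.prems(3) by (auto dest: inj_onD)
    then show ?thesis using k(2)[of j] that by simp
  qed
  have M0: "0 < M" using ek0 Suc.prems(4)[OF k(1)] by simp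
  let ?f' = "\<lambda>x. c k * e k * x powr (e k - 1) +
    ((\<Sum>j\<in>J - {k}. e j * c j * x powr (e j - 1)) + M * c' * x powr (M - 1))"
  show ?case
  proof (rule preserves_Suc[where f' = ?f'])
    fix x :: real assume x: "0 < x"
    have "((\<lambda>x. (\<Sum>j\<in>J. c j * x powr e j) + c' * x powr M) has_real_derivative
       (\<Sum>j\<in>J. c j * (e j * x powr (e j - 1))) + c' * (M * x powr (M - 1))) (at x)"
      using x by (intro DERIV_add DERIV_sum DERIV_cmult has_real_derivative_powr)
    moreover have "(\<Sum>j\<in>J. c j * (e j * x powr (e j - 1))) + c' * (M * x powr (M - 1)) = ?f' x"
      using Suc.prems(1) k(1) by (simp add: sum.remove algebra_simps)
    ultimately show "((\<lambda>x. (\<Sum>j\<in>J. c j * x powr e j) + c' * x powr M) has_real_derivative ?f' x) (at x)"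
      by simp
  next
    have "preserves (Suc n) \<rho> (\<lambda>x. c k * e k * x powr (e k - 1))"
    proof (cases "e k = 0")
      case False
      then show ?thesis using ek0 Suc.prems(5,6)[OF k(1)]
        by (intro preserves_scale preserves_powr admissible_powers_pred) auto
    qed (simp add: preserves_zero)
    moreover have "preserves (Suc n) \<rho> (\<lambda>x. (\<Sum>j\<in>J - {k}. e j * c j * x powr (e j - 1)) + M * c' * x powr (M - 1))"
    proof (rule Suc.IH)
      show "finite (J - {k})" "card (J - {k}) = Suc n" using Suc.prems(1,2) k by auto
      show "inj_on (\<lambda>j. e j - 1) (J - {k})" using Suc.prems(3) by (auto simp: inj_on_def)
      show "e j - 1 < M - 1" "0 < e j * c j" "e j - 1 \<in> admissible_powers (Suc n)" if "j \<in> J - {k}" for j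
        using that ek[OF that] ek0 Suc.prems(4-6)[of j] by (auto intro!: admissible_powers_pred mult_pos_pos)
      show "M * c' \<le> 0" using M0 Suc.prems(8) by (simp add: mult_le_0_iff)
      have "- (M * c') * ratio_const (J - {k}) (\<lambda>j. e j - 1) (M - 1) (\<lambda>j. e j * c j) \<rho> =
         - c' * (M * ratio_const (J - {k}) (\<lambda>j. e j - 1) (M - 1) (\<lambda>j. e j * c j) \<rho>)" by simp
      also have "\<dots> \<le> - c' * ratio_const J e M c \<rho>"
        using Suc.prems k ek0 by (intro mult_left_mono ratio_const_derivative) auto
      also have "\<dots> \<le> 1" by fact
      finally show "- (M * c') * ratio_const (J - {k}) (\<lambda>j. e j - 1) (M - 1) (\<lambda>j. e j * c j) \<rho> \<le> 1" .
    qed fact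
    ultimately show "preserves (Suc n) \<rho> ?f'" by (rule preserves_add)
  next
    fix u :: "nat \<Rightarrow> real" assume "\<And>i. i \<le> Suc n \<Longrightarrow> 0 < u i" "\<And>i j. i \<le> Suc n \<Longrightarrow> j \<le> Suc n \<Longrightarrow> u i * u j < \<rho>"
    then show "psd_fun (Suc (Suc n)) (\<lambda>i j. (\<Sum>r\<in>J. c r * (u i * u j) powr e r) + c' * (u i * u j) powr M)"
      using Suc.prems by (intro rank_one_below_threshold) auto
  qed
qed

section \<open>Necessary conditions\<close>

lemma preserves_rank_one:
  assumes f: "preserves n \<rho> (\<lambda>x. \<Sum>r\<in>R. c r * x powr e r)"
    and "\<rho> > 0" "\<And>i. i < n \<Longrightarrow> t i < ln \<rho> / 2"
  shows "0 \<le> (\<Sum>r\<in>R. c r * (\<Sum>i<n. v i * exp (e r * t i))\<^sup>2)"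
proof -
  have "exp (t i) * exp (t j) < \<rho>" if "i < n" "j < n" for i j
  proof -
    have "t i + t j < ln \<rho>" using assms(3)[of i] assms(3)[of j] that by simp
    then have "exp (t i + t j) < exp (ln \<rho>)" by (simp only: exp_less_cancel_iff)
    then show ?thesis using \<open>\<rho> > 0\<close> by (simp only: exp_add exp_ln)
  qed
  then have "psd_on n \<rho> (\<lambda>i j. exp (t i) * exp (t j))"
    by (simp add: psd_on_def psd_fun_rank_one)
  with f have "psd_fun n (\<lambda>i j. \<Sum>r\<in>R. c r * (exp (t i) * exp (t j)) powr e r)"
    by (simp add: preserves_def)
  from psd_fun_quad[OF this, of v] show ?thesis
    using quad_exp_sum[where f = "\<lambda>x. \<Sum>r\<in>R. c r * x powr e r" and n = n and t = t and R = R
        and c = c and e = e and v = v] by simp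
qed

text \<open>The \<open>n\<close> available moments isolate \<open>s\<close> within \<open>J\<close>.
  Moving all nodes by \<open>- d\<close> and letting \<open>d\<close> tend to infinity makes the
  remaining terms negligible, since their exponents exceed \<open>e s\<close>.\<close>

lemma preserves_coeff_nonneg:
  fixes c e :: "'r \<Rightarrow> real"
  assumes f: "preserves n \<rho> (\<lambda>x. \<Sum>r\<in>R. c r * x powr e r)" and "\<rho> > 0"
    and R: "finite R" "inj_on e R" "J \<subseteq> R" "card J = n" "s \<in> J"
    and larger: "\<And>r. r \<in> R - J \<Longrightarrow> e s < e r"
  shows "0 \<le> c s"
proof -
  have "finite J" "inj_on e J" using R finite_subset inj_on_subset by blast+
  define t where "t i = ln \<rho> / 2 - 1 - real i" for i
  have "inj_on t {..<n}" by (auto simp: t_def inj_on_def)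
  then obtain v where v: "\<And>j. j \<in> J \<Longrightarrow> (\<Sum>i<n. v i * exp (e j * t i)) = of_bool (j = s)"
    using exp_sum_moments[of "{..<n}" J e t "\<lambda>j. of_bool (j = s)"] R \<open>finite J\<close> \<open>inj_on e J\<close> by auto
  define w where "w r = (\<Sum>i<n. v i * exp (e r * t i))" for r
  have "0 \<le> c s + (\<Sum>r\<in>R - J. c r * (w r)\<^sup>2 * exp (- (2 * (e r - e s) * d)))" if "d \<ge> 0" for d
  proof -
    have shift: "(\<Sum>i<n. v i * exp (e r * (t i - d))) = exp (- (e r * d)) * w r" for r
      by (simp add: w_def sum_distrib_left algebra_simps flip: exp_add)
    have "0 \<le> (\<Sum>r\<in>R. c r * (\<Sum>i<n. v i * exp (e r * (t i - d)))\<^sup>2)"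
      using that by (intro preserves_rank_one[OF f \<open>\<rho> > 0\<close>]) (simp add: t_def)
    \<comment> \<open>This factor keeps the term of \<open>s\<close> constant while those outside
      \<open>J\<close> decay.\<close>
    then have "0 \<le> exp (2 * (e s * d)) * (\<Sum>r\<in>R. c r * (exp (- (e r * d)) * w r)\<^sup>2)"
      by (simp add: shift)
    also have "\<dots> = (\<Sum>r\<in>R. c r * (w r)\<^sup>2 * exp (- (2 * (e r - e s) * d)))"
      by (simp add: sum_distrib_left power2_eq_square algebra_simps flip: exp_add)
    also have "\<dots> = (\<Sum>r\<in>R - J. c r * (w r)\<^sup>2 * exp (- (2 * (e r - e s) * d))) +
        (\<Sum>r\<in>J. c r * (w r)\<^sup>2 * exp (- (2 * (e r - e s) * d)))"
      using R by (intro sum.subset_diff)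
    also have "(\<Sum>r\<in>J. c r * (w r)\<^sup>2 * exp (- (2 * (e r - e s) * d))) = (\<Sum>r\<in>J. if r = s then c s else 0)"
      using v by (intro sum.cong refl) (auto simp: w_def)
    finally show ?thesis using \<open>finite J\<close> R by (simp add: add.commute)
  qed
  then have "\<forall>\<^sub>F d in at_top. 0 \<le> c s + (\<Sum>r\<in>R - J. c r * (w r)\<^sup>2 * exp (- (2 * (e r - e s) * d)))"
    by (intro eventually_mono[OF eventually_ge_at_top[of 0]])
  moreover have "((\<lambda>d. exp (- (2 * (e r - e s) * d))) \<longlongrightarrow> 0) at_top" if "r \<in> R - J" for r
  proof (rule filterlim_compose[OF exp_at_bot])
    have "filterlim (\<lambda>d. 2 * (e r - e s) * d) at_top at_top"
      using larger[OF that] by (intro filterlim_tendsto_pos_mult_at_top[OF tendsto_const]) (auto simp: filterlim_ident)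
    then show "filterlim (\<lambda>d. - (2 * (e r - e s) * d)) at_bot at_top"
      by (simp add: filterlim_uminus_at_top)
  qed
  then have "((\<lambda>d. c s + (\<Sum>r\<in>R - J. c r * (w r)\<^sup>2 * exp (- (2 * (e r - e s) * d)))) \<longlongrightarrow>
      c s + (\<Sum>r\<in>R - J. c r * (w r)\<^sup>2 * 0)) at_top"
    by (intro tendsto_intros)
  ultimately have "0 \<le> c s + (\<Sum>r\<in>R - J. c r * (w r)\<^sup>2 * 0)"
    by (intro tendsto_lowerbound) auto
  then show ?thesis by simp
qed

text \<open>Testing with the equality case of Cauchy--Schwarz gives
  \<open>0 \<le> B + c' * B\<^sup>2\<close>. With all nodes in \<open>{lo..<\<tau>}\<close> the mean
  value form yields \<open>B \<ge> S lo\<close>, and then \<open>lo\<close> tends to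
  \<open>\<tau>\<close>.\<close>

lemma preserves_imp_threshold:
  fixes c e :: "'j \<Rightarrow> real"
  assumes f: "preserves n \<rho> (\<lambda>x. (\<Sum>j\<in>J. c j * x powr e j) + c' * x powr M)" and "\<rho> > 0"
    and J: "finite J" "inj_on e J" "card J = n" "\<And>j. j \<in> J \<Longrightarrow> e j < M" "\<And>j. j \<in> J \<Longrightarrow> 0 < c j"
    and "c' \<le> 0"
  shows "- c' * ratio_const J e M c \<rho> \<le> 1"
proof -
  define \<tau> where "\<tau> = ln \<rho> / 2"
  define S where "S x = (\<Sum>j\<in>J. (node_ratio e M J j)\<^sup>2 * (exp (2 * (M - e j) * x) / c j))" for x
  have f': "preserves n \<rho> (\<lambda>x. \<Sum>r\<in>insert None (Some ` J). case_option c' c r * x powr case_option M e r)"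
    using f J(1) by (simp add: sum.reindex image_iff add.commute)
  have "0 \<le> 1 + c' * S lo" if "lo < \<tau>" for lo
  proof -
    define t where "t i = \<tau> - (\<tau> - lo) / real (i + 2)" for i
    have t: "lo \<le> t i" "t i < \<tau>" for i
      using that mult_right_mono[of lo \<tau> "real i"] by (simp_all add: t_def field_simps)
    have "inj_on t {..<n}" using that by (auto simp: t_def inj_on_def)
    then obtain b where b: "\<forall>i\<in>{..<n}. (\<Sum>j\<in>J. b j * exp (e j * t i)) = exp (M * t i)"
      using exp_sum_interpolation[of "{..<n}" J e t "\<lambda>i. exp (M * t i)"] J by auto
    \<comment> \<open>The moments \<open>b j / c j\<close> are the extremal ones: the positive part
      of the form and the moment at \<open>M\<close> both become \<open>B\<close>.\<close>
    obtain v where v: "\<And>j. j \<in> J \<Longrightarrow> (\<Sum>i<n. v i * exp (e j * t i)) = b j / c j"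
      using exp_sum_moments[of "{..<n}" J e t "\<lambda>j. b j / c j"] J \<open>inj_on t {..<n}\<close> by auto
    define B where "B = (\<Sum>j\<in>J. (b j)\<^sup>2 / c j)"
    have "(\<Sum>i<n. v i * exp (M * t i)) = (\<Sum>i<n. \<Sum>j\<in>J. v i * (b j * exp (e j * t i)))"
      using b by (intro sum.cong refl) (simp flip: sum_distrib_left)
    also have "\<dots> = (\<Sum>j\<in>J. \<Sum>i<n. v i * (b j * exp (e j * t i)))" by (rule sum.swap)
    also have "\<dots> = (\<Sum>j\<in>J. b j * (\<Sum>i<n. v i * exp (e j * t i)))"
      by (simp add: sum_distrib_left algebra_simps)
    also have "\<dots> = B" unfolding B_def by (intro sum.cong) (auto simp: v power2_eq_square)
    finally have vM: "(\<Sum>i<n. v i * exp (M * t i)) = B" .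
    have "0 \<le> (\<Sum>r\<in>insert None (Some ` J). case_option c' c r *
        (\<Sum>i<n. v i * exp (case_option M e r * t i))\<^sup>2)"
      using t by (intro preserves_rank_one[OF f' \<open>\<rho> > 0\<close>]) (simp add: \<tau>_def)
    also have "\<dots> = c' * B\<^sup>2 + (\<Sum>j\<in>J. c j * (b j / c j)\<^sup>2)"
      using J(1) v by (simp add: sum.reindex image_iff vM)
    also have "(\<Sum>j\<in>J. c j * (b j / c j)\<^sup>2) = B"
      unfolding B_def using J(5) by (intro sum.cong) (force simp: power2_eq_square)+
    finally have "0 \<le> B * (1 + c' * B)" by (simp add: power2_eq_square algebra_simps)
    moreover have "0 \<le> B" unfolding B_def using J(5) by (intro sum_nonneg) (simp add: less_imp_le)
    ultimately have "0 \<le> 1 + c' * B" by (cases "B = 0") (auto simp: zero_le_mult_iff)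
    moreover have "S lo \<le> B" unfolding S_def B_def
    proof (rule sum_mono)
      fix j assume j: "j \<in> J"
      have "\<exists>\<xi>\<in>{lo..\<tau>}. b j = 1 * node_ratio e M J j * exp ((M - e j) * \<xi>)"
        using J b t j \<open>inj_on t {..<n}\<close>
        by (intro exp_interpolation_coeff[where T = "t ` {..<n}"]) (auto simp: card_image less_imp_le)
      then obtain \<xi> where \<xi>: "lo \<le> \<xi>" "b j = node_ratio e M J j * exp ((M - e j) * \<xi>)" by auto
      have sq: "(exp ((M - e j) * x))\<^sup>2 = exp (2 * (M - e j) * x)" for x
        by (simp add: power2_eq_square flip: exp_add)
      have "exp (2 * (M - e j) * lo) \<le> exp (2 * (M - e j) * \<xi>)"
        using \<xi>(1) J(4)[OF j] by (simp add: mult_left_mono)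
      then have "(node_ratio e M J j)\<^sup>2 * (exp (2 * (M - e j) * lo) / c j) \<le>
          (node_ratio e M J j)\<^sup>2 * (exp (2 * (M - e j) * \<xi>) / c j)"
        using J(5)[OF j] by (intro mult_left_mono divide_right_mono) auto
      then show "(node_ratio e M J j)\<^sup>2 * (exp (2 * (M - e j) * lo) / c j) \<le> (b j)\<^sup>2 / c j"
        by (simp add: \<xi>(2) power_mult_distrib sq)
    qed
    then have "c' * B \<le> c' * S lo" using \<open>c' \<le> 0\<close> by (rule mult_left_mono_neg)
    ultimately show ?thesis by simp
  qed
  then have "\<forall>\<^sub>F x in at_left \<tau>. 0 \<le> 1 + c' * S x"
    by (intro eventually_mono[OF eventually_at_left_real[of "\<tau> - 1"]]) auto
  moreover have "((\<lambda>x. 1 + c' * S x) \<longlongrightarrow> 1 + c' * S \<tau>) (at_left \<tau>)"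
    unfolding S_def by (intro tendsto_intros) (use J(5) in force)
  ultimately have "0 \<le> 1 + c' * S \<tau>" by (intro tendsto_lowerbound) auto
  moreover have "2 * (M - e j) * \<tau> = (M - e j) * ln \<rho>" for j by (simp add: \<tau>_def)
  then have "S \<tau> = ratio_const J e M c \<rho>"
    using \<open>\<rho> > 0\<close> by (simp add: S_def ratio_const_def powr_def)
  ultimately show ?thesis by simp
qed

text \<open>Horn--Loewner: \<open>a\<^bsup>k\<^esup> f\<^bsup>(k)\<^esup>(a) / k!\<close> is nonnegative for \<open>k < n\<close>.
  Testing \<open>f\<close> on \<open>a (1 + s x\<^sub>i x\<^sub>j)\<close> with a vector orthogonal to
  \<open>x\<^bsup>m\<^esup>\<close> for all \<open>m < k\<close> leaves a power series in \<open>s\<close> starting at order \<open>k\<close>.\<close>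

lemma preserves_gbinomial_nonneg:
  fixes c e :: "'r \<Rightarrow> real"
  assumes f: "preserves n \<rho> (\<lambda>x. \<Sum>r\<in>R. c r * x powr e r)" and a: "0 < a" "a < \<rho>" and "k < n"
  shows "0 \<le> (\<Sum>r\<in>R. c r * (e r gchoose k) * a powr e r)"
proof -
  \<comment> \<open>With these nodes \<open>x i ^ m\<close> is an exponential in \<open>i\<close>
    with exponent \<open>m\<close>, so \<open>exp_sum_moments\<close> can prescribe the power
    moments of order below \<open>n\<close>.\<close>
  define x :: "nat \<Rightarrow> real" where "x i = exp (real i)" for i
  obtain v where v: "\<And>m. m < n \<Longrightarrow> (\<Sum>i<n. v i * exp (real m * real i)) = of_bool (m = k)"
    using exp_sum_moments[of "{..<n}" "{..<n}" real real "\<lambda>m. of_bool (m = k)"] by auto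
  define w where "w m = (\<Sum>i<n. v i * x i ^ m)" for m
  have w: "w m = of_bool (m = k)" if "m < n" for m
    using v[OF that] by (simp add: w_def x_def exp_of_nat_mult)
  \<comment> \<open>\<open>X\<close> exceeds every product \<open>x i * x j\<close>, so the binomial
    series converge for \<open>|s| < 1 / X\<close>.\<close>
  define X where "X = exp (real n) * exp (real n)"
  have xx: "0 < x i * x j" "x i * x j < X" if "i < n" "j < n" for i j
    using that by (auto simp: x_def X_def intro!: mult_strict_mono)
  have "0 < X" by (simp add: X_def)
  define g where "g m = (\<Sum>r\<in>R. c r * (e r gchoose m) * a powr e r)" for m
  define d where "d m = g m * (w m)\<^sup>2" for m
  define Q where "Q s = (\<Sum>i<n. \<Sum>j<n. v i * v j * (\<Sum>r\<in>R. c r * (a powr e r * (1 + s * (x i * x j)) powr e r)))" for s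
  have Q_sums: "(\<lambda>m. d m * s ^ m) sums Q s" if "norm s < 1 / X" for s
  proof -
    have "\<bar>s * (x i * x j)\<bar> < 1" if "i < n" "j < n" for i j
    proof -
      have "\<bar>s * (x i * x j)\<bar> \<le> \<bar>s\<bar> * X"
        using xx[OF that] by (auto simp: abs_mult intro!: mult_left_mono)
      also have "\<dots> < 1" using \<open>norm s < 1 / X\<close> \<open>0 < X\<close> by (simp add: field_simps)
      finally show ?thesis .
    qed
    then have "(\<lambda>m. \<Sum>i<n. \<Sum>j<n. v i * v j * (\<Sum>r\<in>R. c r * (a powr e r *
        ((e r gchoose m) * (s * (x i * x j)) ^ m)))) sums Q s"
      unfolding Q_def by (intro sums_sum sums_mult gen_binomial_real) auto
    moreover have "(\<Sum>i<n. \<Sum>j<n. v i * v j * (\<Sum>r\<in>R. c r * (a powr e r *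
        ((e r gchoose m) * (s * (x i * x j)) ^ m)))) = d m * s ^ m" for m
    proof -
      have "(\<Sum>i<n. \<Sum>j<n. v i * v j * (\<Sum>r\<in>R. c r * (a powr e r * ((e r gchoose m) * (s * (x i * x j)) ^ m))))
          = (\<Sum>i<n. \<Sum>j<n. (g m * s ^ m) * (v i * v j * (x i ^ m * x j ^ m)))"
        by (intro sum.cong refl) (simp add: g_def sum_distrib_left sum_distrib_right power_mult_distrib algebra_simps)
      also have "\<dots> = (g m * s ^ m) * (w m)\<^sup>2"
        by (simp add: sum_distrib_left[symmetric] quad_rank_one w_def)
      finally show ?thesis by (simp add: d_def)
    qed
    ultimately show ?thesis by simp
  qed
  \<comment> \<open>The first \<open>k\<close> coefficients vanish, so \<open>Q s / s ^ k\<close>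
    extends continuously to 0 with value \<open>d k\<close>, which is \<open>g k\<close> because
    \<open>w k = 1\<close>.\<close>
  define h where "h s = (if s = 0 then d k else Q s / s ^ k)" for s
  have "(\<lambda>m. d (m + k) * s ^ m) sums h s" if "norm s < 1 / X" for s
  proof (cases "s = 0")
    case True
    have "(\<lambda>m. d (m + k) * 0 ^ m) sums d k" using powser_sums_zero[of "\<lambda>m. d (m + k)"] by simp
    then show ?thesis by (simp add: True h_def)
  next
    case False
    have "d m = 0" if "m < k" for m using w[of m] that \<open>k < n\<close> by (simp add: d_def)
    then have "(\<lambda>m. d (m + k) * s ^ (m + k)) sums Q s"
      using Q_sums[OF that] sums_iff_shift[of "\<lambda>m. d m * s ^ m" k "Q s"] by simp
    from sums_divide[OF this, of "s ^ k"] show ?thesis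
      using False by (simp add: h_def power_add)
  qed
  then have "(h \<longlongrightarrow> d (0 + k)) (at 0)"
    using \<open>0 < X\<close> by (intro powser_limit_0[of "1 / X"]) auto
  then have "(h \<longlongrightarrow> d k) (at_right 0)" by (auto simp: filterlim_at_split)
  \<comment> \<open>The bound on \<open>s\<close> says \<open>a * (1 + s * X) < \<rho>\<close>,
    which keeps the test matrix in the domain.\<close>
  moreover have "0 \<le> h s" if s: "0 < s" "s < (\<rho> / a - 1) / X" for s
  proof -
    have less: "a * (1 + s * (x i * x j)) < \<rho>" if "i < n" "j < n" for i j
    proof -
      have "s * (x i * x j) \<le> s * X" using s xx[OF that] by (intro mult_left_mono) auto
      also have "\<dots> < \<rho> / a - 1" using s(2) \<open>0 < X\<close> by (simp add: field_simps)
      finally show ?thesis using a by (simp add: field_simps)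
    qed
    have "psd_fun n (\<lambda>i j. a * (1 * 1 + s * (x i * x j)))"
      using a s by (intro psd_fun_scale psd_fun_add psd_fun_rank_one) auto
    then have "psd_on n \<rho> (\<lambda>i j. a * (1 + s * (x i * x j)))"
      using less a(1) s(1) by (auto simp: psd_on_def x_def intro!: mult_pos_pos add_pos_pos)
    then have "psd_fun n (\<lambda>i j. \<Sum>r\<in>R. c r * (a * (1 + s * (x i * x j))) powr e r)"
      using f by (simp add: preserves_def)
    from psd_fun_quad[OF this, of v] have "0 \<le> Q s"
      unfolding Q_def using a s xx
      by (subst sum.cong[OF refl sum.cong[OF refl]]) (auto simp: powr_mult less_imp_le)
    then show ?thesis using s by (simp add: h_def)
  qed
  then have "\<forall>\<^sub>F s in at_right 0. 0 \<le> h s"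
    using a \<open>0 < X\<close>
    by (intro eventually_mono[OF eventually_at_right_real[of 0 "(\<rho> / a - 1) / X"]]) auto
  ultimately have "0 \<le> d k" by (intro tendsto_lowerbound) auto
  then show ?thesis using w[OF \<open>k < n\<close>] by (simp add: d_def g_def)
qed

text \<open>The product defining the binomial coefficient is taken one factor past the sign change,
  so exactly its last factor is negative. The bound \<open>\<alpha> < n - 2\<close> keeps this order
  below \<open>n\<close>; for negative \<open>\<alpha>\<close> the order is 1, whence
  \<open>2 \<le> n\<close>.\<close>

lemma gbinomial_neg_of_inadmissible:
  fixes \<alpha> :: real
  assumes "\<alpha> \<notin> admissible_powers n" "2 \<le> n"
  obtains k where "k < n" "\<alpha> gchoose k < 0" "\<And>m. real m < \<alpha> \<Longrightarrow> m < k"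
proof -
  have \<alpha>: "\<alpha> \<notin> \<nat>" "\<alpha> < real n - 2" using assms(1) by (auto simp: admissible_powers_def)
  define k where "k = nat (\<lfloor>\<alpha>\<rfloor> + 1)"
  have "\<alpha> < real k" unfolding k_def by linarith
  have less: "real i < \<alpha>" if "i < k" for i
  proof -
    have "real i \<le> \<alpha>" using that unfolding k_def by linarith
    moreover have "real i \<noteq> \<alpha>" using \<alpha>(1) by auto
    ultimately show ?thesis by simp
  qed
  have "Suc k < n" using \<alpha>(2) assms(2) unfolding k_def by linarith
  moreover have "\<alpha> gchoose Suc k < 0"
  proof -
    have "0 < (\<Prod>i<k. \<alpha> - real i)" using less by (intro prod_pos) auto
    then have "(\<Prod>i<k. \<alpha> - real i) * (\<alpha> - real k) < 0" using \<open>\<alpha> < real k\<close> by (intro mult_pos_neg) auto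
    then show ?thesis
      by (simp add: gbinomial_prod_rev atLeast0LessThan divide_neg_pos del: fact_Suc)
  qed
  moreover have "m < Suc k" if "real m < \<alpha>" for m using that \<open>\<alpha> < real k\<close> by linarith
  ultimately show ?thesis using that by blast
qed

text \<open>As \<open>a \<rightarrow> 0\<close>, the smallest inadmissible exponent \<open>\<alpha>\<close> dominates the Horn--Loewner sum of
  order \<open>k = max (\<lfloor>\<alpha>\<rfloor> + 2) 1\<close>: the binomial coefficients of the smaller exponents, which are natural
  numbers, vanish.\<close>

lemma preserves_imp_admissible:
  fixes c e :: "'r \<Rightarrow> real"
  assumes f: "preserves n \<rho> (\<lambda>x. \<Sum>r\<in>R. c r * x powr e r)" and "\<rho> > 0" "2 \<le> n"
    and R: "finite R" "inj_on e R" "r \<in> R" "0 < c r"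
    and neg: "\<And>s l. s \<in> R \<Longrightarrow> l \<in> R \<Longrightarrow> c s < 0 \<Longrightarrow> e l \<le> e s"
  shows "e r \<in> admissible_powers n"
proof (rule ccontr)
  assume "e r \<notin> admissible_powers n"
  define B where "B = {r \<in> R. 0 < c r \<and> e r \<notin> admissible_powers n}"
  have "finite B" "B \<noteq> {}" using R \<open>e r \<notin> _\<close> by (auto simp: B_def)
  then have "Min (e ` B) \<in> e ` B" by (intro Min_in) auto
  then obtain s where s: "s \<in> B" "e s = Min (e ` B)" by auto
  then have s_min: "e s \<le> e l" if "l \<in> B" for l using that \<open>finite B\<close> by simp
  have sR: "s \<in> R" "0 < c s" "e s \<notin> admissible_powers n" using s(1) by (auto simp: B_def)
  obtain k where k: "k < n" "e s gchoose k < 0" "\<And>m. real m < e s \<Longrightarrow> m < k"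
    using gbinomial_neg_of_inadmissible[OF sR(3) \<open>2 \<le> n\<close>] by blast
  \<comment> \<open>By \<open>neg\<close> a negative coefficient can only sit at the largest
    exponent, so below \<open>e s\<close> a coefficient is zero or positive; in the latter case
    minimality of \<open>e s\<close> makes the exponent natural.\<close>
  have smaller: "c l * (e l gchoose k) = 0" if "l \<in> R" "e l < e s" for l
  proof (cases "0 < c l")
    case True
    then have "e l \<in> admissible_powers n" using s_min[of l] that by (auto simp: B_def)
    then have "e l \<in> \<nat>" using that(2) sR(3) by (auto simp: admissible_powers_def)
    then obtain m where "e l = real m" by (auto elim: Nats_cases)
    then show ?thesis using k(3)[of m] that(2) by (simp add: binomial_eq_0 flip: binomial_gbinomial)
  next
    case False
    then show ?thesis using neg[OF that(1) sR(1)] that(2) by force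
  qed
  let ?h = "\<lambda>l a. c l * (e l gchoose k) * a powr (e l - e s)"
  have "(?h l \<longlongrightarrow> (if l = s then c s * (e s gchoose k) else 0)) (at_right 0)" if "l \<in> R" for l
  proof (cases "e l" "e s" rule: linorder_cases)
    case less
    then show ?thesis using smaller[OF that less] by auto
  next
    case equal
    then have "l = s" using R(2) that sR(1) by (auto dest: inj_onD)
    have "\<forall>\<^sub>F a in at_right (0::real). ?h s a = c s * (e s gchoose k)"
      by (intro eventually_mono[OF eventually_at_right_less]) auto
    from tendsto_eventually[OF this] show ?thesis by (simp only: \<open>l = s\<close> if_True simp_thms)
  next
    case greater
    have "((\<lambda>a::real. a powr (e l - e s)) \<longlongrightarrow> 0) (at_right 0)"
      using greater by (intro tendsto_zero_powrI[where b = "e l - e s"] tendsto_intros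
          eventually_mono[OF eventually_at_right_less]) auto
    from tendsto_mult_right_zero[OF this] show ?thesis using greater by auto
  qed
  then have "((\<lambda>a. \<Sum>l\<in>R. ?h l a) \<longlongrightarrow> (\<Sum>l\<in>R. if l = s then c s * (e s gchoose k) else 0)) (at_right 0)"
    by (intro tendsto_sum) auto
  moreover have "(\<Sum>l\<in>R. if l = s then c s * (e s gchoose k) else 0) = c s * (e s gchoose k)"
    using R(1) sR(1) by simp
  moreover have "0 \<le> (\<Sum>l\<in>R. ?h l a)" if "0 < a" "a < \<rho>" for a
  proof -
    have "0 \<le> a powr (- e s) * (\<Sum>l\<in>R. c l * (e l gchoose k) * a powr e l)"
      using preserves_gbinomial_nonneg[OF f that k(1)] by simp
    then show ?thesis
      by (simp add: sum_distrib_left powr_diff powr_minus field_simps)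
  qed
  then have "\<forall>\<^sub>F a in at_right 0. 0 \<le> (\<Sum>l\<in>R. ?h l a)"
    by (intro eventually_mono[OF eventually_at_right_real[OF \<open>\<rho> > 0\<close>]]) auto
  ultimately have "0 \<le> c s * (e s gchoose k)" by (intro tendsto_lowerbound[of _ _ "at_right 0"]) auto
  then show False using mult_pos_neg[OF sR(2) k(2)] by simp
qed

section \<open>Ratios of Vandermonde determinants\<close>

text \<open>As a polynomial in \<open>x\<close>, the left side is the Lagrange interpolant of the
  monomial of degree \<open>i\<close>; both have degree below the number of nodes and agree
  there.\<close>

lemma node_ratio_power:
  fixes e :: "'j \<Rightarrow> real"
  assumes "finite J" "inj_on e J" "i < card J"
  shows "(\<Sum>l\<in>J. node_ratio e x J l * e l ^ i) = x ^ i"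
proof -
  define L where "L l = (\<Prod>m\<in>J - {l}. [:- e m, 1:])" for l
  define p where "p = (\<Sum>l\<in>J. Polynomial.smult (e l ^ i / (\<Prod>m\<in>J - {l}. e l - e m)) (L l))"
  have p: "poly p x = (\<Sum>l\<in>J. node_ratio e x J l * e l ^ i)" for x
    unfolding p_def L_def node_ratio_def
    by (simp add: poly_sum poly_prod prod_dividef mult.commute)
  have "p = monom 1 i"
  proof (rule poly_eqI_degree)
    fix y assume "y \<in> e ` J"
    then obtain k where k: "k \<in> J" "y = e k" by auto
    have "node_ratio e (e k) J l = (if l = k then 1 else 0)" if "l \<in> J" for l
    proof (cases "l = k")
      case True
      have "(e l - e m) / (e l - e m) = 1" if "m \<in> J - {l}" for m
        using that assms(2) \<open>l \<in> J\<close> by (auto dest: inj_onD)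
      then show ?thesis using True by (simp add: node_ratio_def)
    next
      case False
      then show ?thesis using k assms(1) by (auto simp: node_ratio_def intro!: prod_zero)
    qed
    then have "poly p y = (\<Sum>l\<in>J. if l = k then e k ^ i else 0)"
      unfolding p k(2) by (intro sum.cong) auto
    then show "poly p y = poly (monom 1 i) y"
      using k assms(1) by (simp add: poly_monom)
  next
    have "degree (L l) \<le> card J - 1" if "l \<in> J" for l
      using degree_prod_sum_le[of "J - {l}" "\<lambda>m. [:- e m, 1:]"] that assms(1) by (simp add: L_def)
    then have "degree p \<le> card J - 1"
      unfolding p_def using assms(1) by (intro degree_sum_le) (auto intro: order.trans[OF degree_smult_le])
    then show "degree p < card (e ` J)" using assms by (simp add: card_image)
    show "degree (monom (1::real) i) < card (e ` J)"
      using assms by (simp add: card_image degree_monom_eq)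
  qed
  then show ?thesis using p[of x] by (simp add: poly_monom)
qed

text \<open>A nonzero kernel vector of the matrix would be the coefficient vector of a polynomial of
  degree below \<open>N\<close> with \<open>N\<close> roots.\<close>

lemma vandermonde_det_nonzero:
  assumes "inj_on n {..<N}"
  shows "vandermonde_det (exponents N n) \<noteq> 0"
proof
  let ?W = "mat N N (\<lambda>(k, i). n k ^ i)"
  assume "vandermonde_det (exponents N n) = 0"
  moreover have "mat N N (\<lambda>(k, i). (exponents N n ! k) ^ i) = ?W" by (rule eq_matI) (auto simp: exponents_def)
  ultimately have "det ?W = 0" by (simp add: vandermonde_det_def exponents_def)
  then obtain v where v: "v \<in> carrier_vec N" "v \<noteq> 0\<^sub>v N" "?W *\<^sub>v v = 0\<^sub>v N"
    using det_0_iff_vec_prod_zero[of ?W N] by auto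
  define p where "p = (\<Sum>i<N. monom (vec_index v i) i)"
  have "N \<noteq> 0" using v by auto
  have "p = 0"
  proof (rule poly_eqI_degree)
    fix y assume "y \<in> n ` {..<N}"
    then obtain k where k: "k < N" "y = n k" by auto
    have "vec_index (?W *\<^sub>v v) k = 0" using v(3) k by simp
    then show "poly p y = poly 0 y"
      using k v(1) by (simp add: p_def poly_sum poly_monom k scalar_prod_def atLeast0LessThan mult.commute)
  next
    have "degree p \<le> N - 1" unfolding p_def
      by (intro degree_sum_le) (auto intro: order.trans[OF degree_monom_le])
    then show "degree p < card (n ` {..<N})" "degree (0 :: real poly) < card (n ` {..<N})"
      using assms \<open>N \<noteq> 0\<close> by (simp_all add: card_image)
  qed
  have "vec_index v i = 0" if "i < N" for i
  proof -
    have "vec_index v i = Polynomial.coeff p i" using that by (simp add: p_def coeff_sum)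
    then show ?thesis by (simp add: \<open>p = 0\<close>)
  qed
  then have "v = 0\<^sub>v N" using v(1) by (intro eq_vecI) auto
  then show False using v(2) by simp
qed

text \<open>By Lagrange interpolation the row of powers of \<open>M\<close> is the combination of the rows of the
  Vandermonde matrix with weights \<open>node_ratio\<close>; hence the swapped matrix is the original one
  multiplied by a matrix \<open>T\<close> of determinant \<open>\<plusminus>\<close> \<open>node_ratio\<close>.\<close>

lemma vandermonde_det_swap:
  assumes inj: "inj_on n {..<N}" and "j < N"
  shows "(vandermonde_det (exponents_swap N n M j))\<^sup>2 / (vandermonde_det (exponents N n))\<^sup>2 =
    (node_ratio n M {..<N} j)\<^sup>2"
proof -
  obtain m where N: "N = Suc m" using \<open>j < N\<close> by (cases N) auto
  let ?w = "node_ratio n M {..<N}"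
  \<comment> \<open>\<open>\<sigma>\<close> enumerates the indices other than \<open>j\<close>, in
    the order of the list \<open>exponents_swap\<close>.\<close>
  define \<sigma> where "\<sigma> k = (if k < j then k else Suc k)" for k
  define W where "W = mat N N (\<lambda>(k, i). n k ^ i)"
  define T where "T = mat N N (\<lambda>(k, l). if k < m then of_bool (l = \<sigma> k) else ?w l)"
  define S where "S = mat N N (\<lambda>(k, i). (exponents_swap N n M j ! k) ^ i)"
  have W: "W \<in> carrier_mat N N" and T: "T \<in> carrier_mat N N" by (simp_all add: W_def T_def)
  have len: "length (exponents_swap N n M j) = N"
    using \<open>j < N\<close> by (simp add: exponents_swap_def)
  have row: "exponents_swap N n M j ! k = (if k < m then n (\<sigma> k) else M)" if "k < N" for k
    using that \<open>j < N\<close> N by (auto simp: exponents_swap_def \<sigma>_def nth_append)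
      (rule arg_cong[where f = n], linarith)
  have \<sigma>_less: "\<sigma> k < N" if "k < m" for k using that N by (simp add: \<sigma>_def)
  have "S = T * W"
  proof (rule eq_matI)
    fix k i assume "k < dim_row (T * W)" "i < dim_col (T * W)"
    then have ki: "k < N" "i < N" by (simp_all add: T_def W_def)
    have "(T * W) $$ (k, i) = (\<Sum>l<N. (if k < m then of_bool (l = \<sigma> k) else ?w l) * n l ^ i)"
      using ki by (simp add: T_def W_def scalar_prod_def atLeast0LessThan)
    also have "\<dots> = (if k < m then n (\<sigma> k) ^ i else M ^ i)"
    proof (cases "k < m")
      case True
      then show ?thesis using \<sigma>_less by (simp add: sum_of_bool_eq)
    next
      case False
      then show ?thesis using inj ki by (simp add: node_ratio_power)
    qed
    also have "\<dots> = S $$ (k, i)" using ki by (simp add: S_def row)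
    finally show "S $$ (k, i) = (T * W) $$ (k, i)" by simp
  qed (simp_all add: S_def T_def W_def)
  then have "det S = det T * det W" using det_mult[OF T W] by simp
  \<comment> \<open>Column \<open>j\<close> of \<open>T\<close> has its only possibly nonzero entry
    in the last row, and deleting both leaves the identity; the sign of the cofactor is lost on
    squaring.\<close>
  moreover have "(det T)\<^sup>2 = (?w j)\<^sup>2"
  proof -
    have "T $$ (i, j) = 0" if "i < m" for i
      using that \<open>j < N\<close> N by (simp add: T_def \<sigma>_def)
    then have "det T = T $$ (m, j) * cofactor T m j"
      using laplace_expansion_column[OF T \<open>j < N\<close>] by (simp add: N)
    moreover have "T $$ (m, j) = ?w j" using \<open>j < N\<close> by (simp add: T_def N)
    moreover have "mat_delete T m j = 1\<^sub>m m"
    proof (rule eq_matI)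
      fix i l assume "i < dim_row (1\<^sub>m m :: real mat)" "l < dim_col (1\<^sub>m m :: real mat)"
      then have "i < m" "l < m" by auto
      then show "mat_delete T m j $$ (i, l) = 1\<^sub>m m $$ (i, l)"
        using \<open>j < N\<close> by (auto simp: mat_delete_def T_def \<sigma>_def N)
    qed (simp_all add: mat_delete_def T_def N)
    ultimately show ?thesis by (simp add: cofactor_def power_mult_distrib flip: power_mult)
  qed
  moreover have "vandermonde_det (exponents_swap N n M j) = det S"
    by (simp add: vandermonde_det_def len S_def)
  moreover have "vandermonde_det (exponents N n) = det W"
    unfolding vandermonde_det_def W_def by (intro arg_cong[where f = det] eq_matI) (auto simp: exponents_def)
  ultimately show ?thesis
    using vandermonde_det_nonzero[OF inj] by (simp add: power_mult_distrib)
qed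

lemma threshold_const_eq:
  assumes "inj_on n {..<N}"
  shows "threshold_const N n M c \<rho> = ratio_const {..<N} n M c \<rho>"
  unfolding threshold_const_def ratio_const_def
  by (intro sum.cong) (auto simp: vandermonde_det_swap[OF assms])

lemma ratio_const_pos:
  assumes "finite J" "J \<noteq> {}" "inj_on e J" "\<And>j. j \<in> J \<Longrightarrow> e j < M" "\<And>j. j \<in> J \<Longrightarrow> 0 < c j" "\<rho> > 0"
  shows "0 < ratio_const J e M c \<rho>"
  unfolding ratio_const_def
proof (rule sum_pos)
  fix j assume j: "j \<in> J"
  have "M - e l \<noteq> 0 \<and> e j - e l \<noteq> 0" if "l \<in> J - {j}" for l
    using that j assms(3) assms(4)[of l] by (auto dest: inj_onD)
  then have "node_ratio e M J j \<noteq> 0" using assms(1) by (simp add: node_ratio_def)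
  then show "0 < (node_ratio e M J j)\<^sup>2 * (\<rho> powr (M - e j) / c j)"
    using assms(5)[OF j] \<open>\<rho> > 0\<close> by simp
qed (use assms in auto)

section \<open>The characterization\<close>

theorem theorem5p2:
  fixes N :: nat and n c :: "nat \<Rightarrow> real" and M c' \<rho> :: real and f :: "real \<Rightarrow> real"
  assumes "N \<ge> 2"
    and "\<And>i j. i < j \<Longrightarrow> j < N \<Longrightarrow> n i < n j"
    and "n (N - 1) < M"
    and "\<rho> > 0"
    and "\<And>x. 0 < x \<Longrightarrow> x < \<rho> \<Longrightarrow> f x = (\<Sum>j<N. c j * x powr n j) + c' * x powr M"
  shows "((\<forall>A \<in> PSD N {0<..<\<rho>}. psd_mat N (map_mat f A)) \<longleftrightarrow>
            nonneg_case N n M c c' \<or> negative_case N n M c c' \<rho>) \<and>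
         \<not> (nonneg_case N n M c c' \<and> negative_case N n M c c' \<rho>) \<and>
         (negative_case N n M c c' \<rho> \<longrightarrow>
            (\<exists>A \<in> PSD (N + 1) {0<..<\<rho>}. \<not> psd_mat (N + 1) (map_mat f A)))"
proof -
  \<comment> \<open>Appending \<open>M\<close> and \<open>c'\<close> as index \<open>N\<close> makes
    the function one sum over \<open>{..<Suc N}\<close> with increasing exponents.\<close>
  define e where "e r = (if r < N then n r else M)" for r
  define d where "d r = (if r < N then c r else c')" for r
  have n_less_M: "n j < M" if "j < N" for j
  proof (cases "j = N - 1")
    case False
    then have "n j < n (N - 1)" using that by (intro assms(2)) auto
    then show ?thesis using assms(3) by simp
  qed (use assms(3) in simp)
  have inj_n: "inj_on n {..<N}"
    by (rule inj_onI) (metis assms(2) lessThan_iff less_irrefl linorder_neqE_nat)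
  have e_less: "e r < e s" if "r < s" "s < Suc N" for r s
    using that assms(2)[of r s] n_less_M[of r] by (auto simp: e_def)
  have inj_e: "inj_on e {..<Suc N}"
    by (rule inj_onI) (metis e_less lessThan_iff less_irrefl linorder_neqE_nat)
  let ?F = "\<lambda>x. (\<Sum>j<N. c j * x powr n j) + c' * x powr M"
  have F_eq: "?F = (\<lambda>x. \<Sum>r<Suc N. d r * x powr e r)" by (simp add: e_def d_def)
  have preserves_f: "preserves k \<rho> f \<longleftrightarrow> preserves k \<rho> ?F" for k
    by (rule preserves_cong) (rule assms(5))
  let ?K = "threshold_const N n M c \<rho>"
  have K_eq: "?K = ratio_const {..<N} n M c \<rho>" by (rule threshold_const_eq[OF inj_n])
  have K_iff: "- inverse ?K \<le> c' \<longleftrightarrow> - c' * ?K \<le> 1" if "\<And>j. j < N \<Longrightarrow> 0 < c j"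
  proof -
    have "0 < ?K" unfolding K_eq
      using assms(1,4) that n_less_M inj_n by (intro ratio_const_pos) (auto simp: lessThan_empty_iff)
    then show ?thesis by (auto simp: field_simps)
  qed
  have necessary: "nonneg_case N n M c c' \<or> negative_case N n M c c' \<rho>" if "preserves N \<rho> ?F"
  proof -
    note F = that[unfolded F_eq]
    \<comment> \<open>Here \<open>N\<close> is the only index outside \<open>J\<close>, and its
      exponent \<open>M\<close> is the largest.\<close>
    have c_nonneg: "0 \<le> c j" if "j < N" for j
      using preserves_coeff_nonneg[OF F assms(4) _ inj_e, of "{..<N}" j] that e_less
      by (auto simp: d_def less_Suc_eq)
    \<comment> \<open>Only index \<open>N\<close> can carry a negative coefficient, and it has the
      largest exponent.\<close>
    have adm: "e r \<in> admissible_powers N" if "r < Suc N" "0 < d r" for r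
    proof (rule preserves_imp_admissible[OF F assms(4,1) _ inj_e])
      fix s l assume "s \<in> {..<Suc N}" "l \<in> {..<Suc N}" "d s < 0"
      then show "e l \<le> e s" using c_nonneg[of s] e_less[of l s]
        by (cases "l = s") (auto simp: d_def not_less less_Suc_eq less_imp_le split: if_splits)
    qed (use that in auto)
    have n_adm: "n j \<in> admissible_powers N" if "j < N" "0 < c j" for j
      using adm[of j] that by (simp add: e_def d_def)
    show ?thesis
    proof (cases "0 \<le> c'")
      case True
      then show ?thesis using c_nonneg n_adm adm[of N] by (auto simp: nonneg_case_def e_def d_def)
    next
      case False
      \<comment> \<open>A vanishing \<open>c j\<close> would leave only \<open>N\<close> exponents,
        \<open>M\<close> among them; all their moments could be prescribed in dimension
        \<open>N\<close>, forcing \<open>0 \<le> c'\<close>.\<close>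
      have c_pos: "0 < c j" if "j < N" for j
      proof (rule ccontr)
        assume "\<not> 0 < c j"
        then have "d j = 0" using c_nonneg[OF that] that by (simp add: d_def)
        then have eq: "(\<lambda>x. \<Sum>r<Suc N. d r * x powr e r) = (\<lambda>x. \<Sum>r\<in>{..<Suc N} - {j}. d r * x powr e r)"
          using that by (simp add: sum.remove[of "{..<Suc N}" j] del: sum.lessThan_Suc)
        have "0 \<le> d N"
          using that inj_e by (intro preserves_coeff_nonneg[OF F[unfolded eq] assms(4), where J = "{..<Suc N} - {j}"])
            (auto intro: inj_on_subset)
        then show False using False by (simp add: d_def)
      qed
      have "- c' * ratio_const {..<N} n M c \<rho> \<le> 1"
        using False n_less_M c_pos inj_n by (intro preserves_imp_threshold[OF that assms(4)]) auto
      then show ?thesis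
        using False c_pos n_adm K_iff by (simp add: negative_case_def K_eq)
    qed
  qed
  have sufficient: "preserves N \<rho> ?F" if "nonneg_case N n M c c' \<or> negative_case N n M c c' \<rho>"
    using that
  proof
    assume *: "nonneg_case N n M c c'"
    have "preserves N \<rho> (\<lambda>x. d r * x powr e r)" if "r < Suc N" for r
    proof (cases "d r = 0")
      case True
      then show ?thesis by (simp add: preserves_zero)
    next
      case False
      then have "0 < d r" "e r \<in> admissible_powers N"
        using * that unfolding nonneg_case_def d_def e_def by (auto simp: less_le)
      then show ?thesis by (intro preserves_scale preserves_powr) auto
    qed
    then show ?thesis unfolding F_eq by (intro preserves_sum) auto
  next
    assume *: "negative_case N n M c c' \<rho>"
    then have "- c' * ratio_const {..<N} n M c \<rho> \<le> 1"
      using K_iff by (simp add: negative_case_def K_eq)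
    moreover have "N = Suc (N - 1)" using assms(1) by simp
    ultimately show ?thesis
      using * assms(4) inj_n n_less_M preserves_below_threshold[of "{..<N}" "N - 1" n M c \<rho> c']
      by (auto simp: negative_case_def)
  qed
  \<comment> \<open>In dimension \<open>N + 1\<close> the moments of all \<open>N + 1\<close>
    exponents can be prescribed, which isolates the negative term of \<open>M\<close>.\<close>
  have "\<not> preserves (N + 1) \<rho> ?F" if "negative_case N n M c c' \<rho>"
  proof
    assume "preserves (N + 1) \<rho> ?F"
    then have "0 \<le> d N" unfolding F_eq
      using preserves_coeff_nonneg[OF _ assms(4) _ inj_e, of "N + 1" d "{..<Suc N}" N] by simp
    then show False using that by (simp add: d_def negative_case_def)
  qed
  moreover have "\<not> (nonneg_case N n M c c' \<and> negative_case N n M c c' \<rho>)"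
    by (auto simp: nonneg_case_def negative_case_def)
  ultimately show ?thesis
    using necessary sufficient
    unfolding preserves_PSD_iff[symmetric] preserves_f[symmetric] by (auto simp: preserves_PSD_iff)
qed

end
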